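(* Let $H$ be a complex Hilbert space and let $M_1$ and $M_2$ be two closed subspaces of $H$ such that $M_1\neq H$ or $M_2\neq H$. Then $$\overline{W(P_{M_2}P_{M_1})}=\overline{\mathrm{conv}\Big(\bigcup_{\lambda\in\sigma(P_{M_2}P_{M_1})}\mathscr{E}(\lambda)\Big)}.$$
   Context: For a closed subspace $M$ of $H$, $P_M$ denotes the orthogonal projection of $H$ onto $M$. For a bounded operator $T$ on $H$, $\sigma(T)$ is its spectrum and $W(T)=\{\langle Tx,x\rangle : x\in H,\ \|x\|=1\}\subset\mathbb{C}$ is its numerical range. The spectrum of a product of two orthogonal projections is a compact subset of $[0,1]$. For $\lambda\in[0,1]$, $\mathscr{E}(\lambda)\subset\mathbb{C}$ denotes the (closed) domain delimited by the ellipse with foci $0$ and $\lambda$ and minor axis (full) length $\sqrt{\lambda(1-\lambda)}$; that is, for $0<\lambda<1$, $\mathscr{E}(\lambda)=\{x+iy: x,y\in\mathbb{R},\ \frac{(x-\lambda/2)^2}{\lambda/4}+\frac{y^2}{\lambda(1-\lambda)/4}\le 1\}$, and $\mathscr{E}(0)=\{0\}$, $\mathscr{E}(1)=[0,1]$. $\mathrm{conv}(E)$ is the convex hull of $E\subset\mathbb{C}$ and the overline denotes closure in $\mathbb{C}$. *)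

theory Defs
  imports "HOL-Analysis.Analysis"
begin

text \<open>
  A complex inner product space is modelled as a real one together with a compatible
  complex structure: the real inner product is the real part of the complex one, so that
  the norm is the usual \<open>sqrt \<langle>x, x\<rangle>\<close>, and positive definiteness is inherited from
  \<^class>\<open>real_inner\<close>. The complex inner product is linear in its first argument.
\<close>

class complex_inner = real_inner +
  fixes scaleC :: "complex \<Rightarrow> 'a \<Rightarrow> 'a"  (infixr \<open>*\<^sub>C\<close> 75)
    and cinner :: "'a \<Rightarrow> 'a \<Rightarrow> complex"
  assumes scaleC_add_right: "c *\<^sub>C (x + y) = c *\<^sub>C x + c *\<^sub>C y"
    and scaleC_add_left: "(c + d) *\<^sub>C x = c *\<^sub>C x + d *\<^sub>C x"
    and scaleC_scaleC: "c *\<^sub>C (d *\<^sub>C x) = (c * d) *\<^sub>C x"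
    and scaleR_scaleC: "r *\<^sub>R x = complex_of_real r *\<^sub>C x"
    and cinner_commute: "cinner x y = cnj (cinner y x)"
    and cinner_add_left: "cinner (x + y) z = cinner x z + cinner y z"
    and cinner_scaleC_left: "cinner (c *\<^sub>C x) y = c * cinner x y"
    and inner_eq_Re_cinner: "inner x y = Re (cinner x y)"

class complex_hilbert_space = complex_inner + banach

global_interpretation complex_vector:
    vector_space "scaleC :: complex \<Rightarrow> 'a \<Rightarrow> 'a::complex_inner"
  defines csubspace = complex_vector.subspace
proof
  fix x :: 'a
  show "1 *\<^sub>C x = x"
    using scaleR_scaleC[of 1 x] by simp
qed (simp_all add: scaleC_add_right scaleC_add_left scaleC_scaleC)

lemma power2_norm_eq_cinner:
  fixes x :: "'a::complex_inner"
  shows "complex_of_real ((norm x)\<^sup>2) = cinner x x"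
proof (rule complex_eqI)
  show "Im (complex_of_real ((norm x)\<^sup>2)) = Im (cinner x x)"
    using arg_cong[OF cinner_commute[of x x], of Im] by simp
qed (simp add: power2_norm_eq_inner inner_eq_Re_cinner)

instantiation complex :: complex_hilbert_space
begin

definition scaleC_complex :: "complex \<Rightarrow> complex \<Rightarrow> complex"
  where "scaleC_complex c x = c * x"

definition cinner_complex :: "complex \<Rightarrow> complex \<Rightarrow> complex"
  where "cinner_complex x y = x * cnj y"

instance
  by standard
    (auto simp: scaleC_complex_def cinner_complex_def algebra_simps scaleR_conv_of_real
      inner_complex_def)

end

definition bounded_clinear :: "('a::complex_inner \<Rightarrow> 'a) \<Rightarrow> bool"
  where "bounded_clinear T \<longleftrightarrow>
    bounded_linear T \<and> (\<forall>c x. T (c *\<^sub>C x) = c *\<^sub>C T x)"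

definition spectrum :: "('a::complex_inner \<Rightarrow> 'a) \<Rightarrow> complex set"
  where "spectrum T = {z. \<not> (\<exists>S. bounded_clinear S \<and>
    (\<forall>x. S (z *\<^sub>C x - T x) = x) \<and> (\<forall>x. z *\<^sub>C S x - T (S x) = x))}"

definition numerical_range :: "('a::complex_inner \<Rightarrow> 'a) \<Rightarrow> complex set"
  where "numerical_range T = {cinner (T x) x | x. norm x = 1}"

text \<open>
  For a closed subspace of a Hilbert space the vector described below exists and is
  unique, by the projection theorem; otherwise the value may be unspecified.
\<close>

definition orth_proj :: "'a::complex_inner set \<Rightarrow> 'a \<Rightarrow> 'a"
  where "orth_proj M x = (THE y. y \<in> M \<and> (\<forall>m\<in>M. cinner (x - y) m = 0))"

text \<open>
  The closed region bounded by the ellipse with foci \<open>0\<close> and \<open>l\<close> and full minor axis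
  \<open>sqrt (l * (1 - l))\<close>, hence full major axis \<open>sqrt l\<close>; it degenerates to a point
  or a segment for \<open>l = 0\<close> and \<open>l = 1\<close>. Only meaningful for \<open>l \<in> {0..1}\<close>.
\<close>

definition elliptic_domain :: "real \<Rightarrow> complex set"
  where "elliptic_domain l =
    (if l = 0 then {0}
     else if l = 1 then complex_of_real ` {0..1}
     else {z. (Re z - l / 2)\<^sup>2 / (l / 4) + (Im z)\<^sup>2 / (l * (1 - l) / 4) \<le> 1})"

end

theory Submission
  imports Defs
begin

text \<open>
  Write \<open>P\<close> and \<open>Q\<close> for the projections onto \<open>M1\<close> and \<open>M2\<close>, and \<open>D = P Q P\<close>. The operator
  \<open>D\<close> is positive and self-adjoint and has the same nonzero spectrum as \<open>Q P\<close>, by the usual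
  relation between the spectra of \<open>AB\<close> and \<open>BA\<close>; being self-adjoint, it has only approximate
  eigenvalues in its spectrum. So a nonzero point of the spectrum of \<open>Q P\<close> is a number
  \<open>t \<in> {0<..1}\<close> with unit vectors \<open>x n\<close> such that \<open>D (x n) - t x n\<close> tends to \<open>0\<close>
  (\<open>spectrum_QP_imp_approx_eigenvalue_D\<close>, \<open>approx_eigenvalue_D_imp_spectrum_QP\<close>). The point
  \<open>0\<close> lies in the spectrum and in the numerical range because one of the subspaces is proper.

  Each elliptic domain lies in the closed numerical range: two projections in general position
  look like two lines in a plane at an angle with squared cosine \<open>t\<close>. Concretely, with
  \<open>u = P (x n)\<close> and \<open>v = Q u - t u\<close>, the operator \<open>Q P\<close> acts asymptotically on the span of
  \<open>u\<close> and \<open>v\<close> as a 2 by 2 matrix, whose numerical range is the elliptic domain of \<open>t\<close>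
  when \<open>t < 1\<close>; for \<open>t = 1\<close> it is the point \<open>1\<close>, which is joined to \<open>0\<close> by convexity
  (\<open>two_dimensional_compression\<close>, \<open>elliptic_domain_parametrization\<close>). The closed convex hull
  is then covered as well by the Toeplitz-Hausdorff theorem (\<open>convex_numerical_range\<close>).

  Conversely, it suffices to compare support functions. Fix a direction \<open>a\<close> of modulus one. The
  supremum \<open>m\<close> of \<open>Re (cnj a \<langle>Q P x, x\<rangle>)\<close> over unit vectors is an approximate eigenvalue
  of the self-adjoint part of \<open>cnj a Q P\<close>. Eliminating in this eigenvalue equation shows that
  \<open>D\<^sup>2 - (1 + 4 m Re a) D + 4 m\<^sup>2\<close> almost annihilates \<open>P x\<close>, so if \<open>m > 0\<close>, a root \<open>t\<close>
  of this polynomial is an approximate eigenvalue of \<open>D\<close>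
  (\<open>approx_eigenvalue_D_from_real_part\<close>). Solved for \<open>m\<close>, the equation satisfied by \<open>t\<close>
  says that \<open>m\<close> is at most the support function of the elliptic domain of \<open>t\<close> in the
  direction \<open>a\<close> (\<open>elliptic_domain_support\<close>).
\<close>

section \<open>Complex inner product spaces\<close>

lemma cinner_add_right: "cinner x (y + z) = cinner x y + cinner x z"
  by (metis cinner_add_left cinner_commute complex_cnj_add)

lemma cinner_scaleC_right: "cinner x (c *\<^sub>C y) = cnj c * cinner x y"
  by (metis cinner_commute cinner_scaleC_left complex_cnj_mult)

lemma norm_scaleC: "norm (c *\<^sub>C x) = cmod c * norm x" for x :: "'a::complex_inner"
proof -
  have "complex_of_real ((norm (c *\<^sub>C x))\<^sup>2) = complex_of_real ((cmod c * norm x)\<^sup>2)"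
    by (simp only: power2_norm_eq_cinner[of "c *\<^sub>C x"] cinner_scaleC_left cinner_scaleC_right
        power_mult_distrib of_real_mult complex_norm_square[of c] power2_norm_eq_cinner[of x] mult_ac)
  then show ?thesis
    by (simp only: of_real_eq_iff) (simp add: power2_eq_iff_nonneg)
qed

lemma Re_mult_cinner: "Re (c * cinner x y) = inner (c *\<^sub>C x) y"
  by (simp only: inner_eq_Re_cinner cinner_scaleC_left)

text \<open>
  Rotating \<open>x\<close> by a phase makes the complex inner product real, so that the Cauchy-Schwarz
  inequality of the underlying real space applies.
\<close>

lemma norm_cinner_le: "cmod (cinner x y) \<le> norm x * norm y" for x y :: "'a::complex_inner"
proof (cases "cinner x y = 0")
  case False
  define c where "c = cnj (sgn (cinner x y))"
  have "c * cinner x y = complex_of_real (cmod (cinner x y))"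
    using False
    by (simp add: c_def sgn_div_norm scaleR_conv_of_real divide_simps complex_norm_square[symmetric]
        mult.commute[of "cnj _"]) (simp add: power2_eq_square)
  then have "cmod (cinner x y) = inner (c *\<^sub>C x) y"
    by (metis Re_complex_of_real Re_mult_cinner)
  also have "\<dots> \<le> norm (c *\<^sub>C x) * norm y"
    by (rule norm_cauchy_schwarz)
  also have "\<dots> = norm x * norm y"
    using False by (simp add: norm_scaleC c_def norm_sgn)
  finally show ?thesis .
qed simp

interpretation cinner: bounded_bilinear "cinner :: 'a::complex_inner \<Rightarrow> 'a \<Rightarrow> complex"
proof
  show "\<exists>K. \<forall>x y::'a. norm (cinner x y) \<le> norm x * norm y * K"
    by (rule exI[of _ 1]) (simp add: norm_cinner_le)
qed (auto simp: cinner_add_left cinner_add_right scaleR_scaleC cinner_scaleC_left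
    cinner_scaleC_right scaleR_conv_of_real scaleC_complex_def)

declare cinner.zero_left [simp] cinner.zero_right [simp]

interpretation scaleC: bounded_bilinear "scaleC :: complex \<Rightarrow> 'a::complex_inner \<Rightarrow> 'a"
proof
  show "\<exists>K. \<forall>c. \<forall>x::'a. norm (c *\<^sub>C x) \<le> norm c * norm x * K"
    by (rule exI[of _ 1]) (simp add: norm_scaleC)
qed (auto simp: scaleC_add_left scaleC_add_right scaleR_scaleC scaleC_scaleC
    scaleR_conv_of_real scaleC_complex_def mult.commute)

lemma cinner_self: "cinner x x = complex_of_real ((norm x)\<^sup>2)"
  by (simp only: power2_norm_eq_cinner)

lemma bounded_clinear_linear: "bounded_clinear T \<Longrightarrow> bounded_linear T"
  by (simp add: bounded_clinear_def)

lemma bounded_clinear_scaleC: "bounded_clinear T \<Longrightarrow> T (c *\<^sub>C x) = c *\<^sub>C T x"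
  by (simp add: bounded_clinear_def)

section \<open>Orthogonal projections\<close>

text \<open>
  A minimising sequence for the distance from \<open>x\<close> to \<open>M\<close> is Cauchy by the parallelogram
  law, because the midpoints of its members again lie in \<open>M\<close>.
\<close>

lemma closest_point_in_closed_subspace:
  fixes M :: "'a::{real_inner, banach} set"
  assumes "subspace M" "closed M"
  obtains y where "y \<in> M" "\<And>m. m \<in> M \<Longrightarrow> norm (x - y) \<le> norm (x - m)"
proof -
  define d where "d = (INF m\<in>M. norm (x - m))"
  have ne: "M \<noteq> {}"
    using assms(1) subspace_0 by blast
  have bdd: "bdd_below ((\<lambda>m. norm (x - m)) ` M)"
    by (rule bdd_belowI[of _ 0]) auto
  have d_le: "d \<le> norm (x - m)" if "m \<in> M" for m
    unfolding d_def by (rule cINF_lower[OF bdd that])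
  have d0: "d \<ge> 0"
    unfolding d_def using ne by (intro cINF_greatest) auto
  have "\<exists>m\<in>M. norm (x - m) < d + inverse (real (Suc n))" for n
    using cINF_less_iff[OF ne bdd, of "d + inverse (real (Suc n))"] by (simp add: d_def)
  then obtain s where s: "\<And>n. s n \<in> M" "\<And>n. norm (x - s n) < d + inverse (real (Suc n))"
    by metis
  have lim: "(\<lambda>n. norm (x - s n)) \<longlonglongrightarrow> d"
  proof (rule tendsto_sandwich[where f = "\<lambda>_. d" and h = "\<lambda>n. d + inverse (real (Suc n))"])
    show "(\<lambda>n. d + inverse (real (Suc n))) \<longlonglongrightarrow> d"
      using tendsto_add[OF tendsto_const[of d] LIMSEQ_inverse_real_of_nat] by simp
  qed (use s(1) d_le less_imp_le[OF s(2)] in auto)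
  have par: "(norm (s m - s n))\<^sup>2 \<le> 2 * ((norm (x - s m))\<^sup>2 - d\<^sup>2) + 2 * ((norm (x - s n))\<^sup>2 - d\<^sup>2)" for m n
  proof -
    have mid: "(1 / 2) *\<^sub>R (s m + s n) \<in> M"
      using s(1) assms(1) by (intro subspace_scale subspace_add)
    have "d\<^sup>2 \<le> (norm (x - (1 / 2) *\<^sub>R (s m + s n)))\<^sup>2"
      using d_le[OF mid] d0 by (simp add: power_mono)
    moreover have "(norm (s m - s n))\<^sup>2 + 4 * (norm (x - (1 / 2) *\<^sub>R (s m + s n)))\<^sup>2
        = 2 * (norm (x - s m))\<^sup>2 + 2 * (norm (x - s n))\<^sup>2"
      by (simp add: power2_norm_eq_inner inner_diff_left inner_diff_right inner_add_left
          inner_add_right inner_commute algebra_simps)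
    ultimately show ?thesis by simp
  qed
  have "Cauchy s"
  proof (rule metric_CauchyI)
    fix e :: real assume "e > 0"
    have "(\<lambda>n. (norm (x - s n))\<^sup>2 - d\<^sup>2) \<longlonglongrightarrow> d\<^sup>2 - d\<^sup>2"
      by (intro tendsto_intros lim)
    then have "eventually (\<lambda>n. (norm (x - s n))\<^sup>2 - d\<^sup>2 < e\<^sup>2 / 4) sequentially"
      by (rule order_tendstoD) (use \<open>e > 0\<close> in simp)
    then obtain N where N: "\<And>n. n \<ge> N \<Longrightarrow> (norm (x - s n))\<^sup>2 - d\<^sup>2 < e\<^sup>2 / 4"
      by (auto simp: eventually_sequentially)
    have "dist (s m) (s n) < e" if "m \<ge> N" "n \<ge> N" for m n
    proof -
      have less: "a < b" if "a \<le> 2 * p + 2 * q" "p < b / 4" "q < b / 4" for a b p q :: real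
        using that by linarith
      have "(norm (s m - s n))\<^sup>2 < e\<^sup>2"
        by (rule less[OF par[of m n] N[OF that(1)] N[OF that(2)]])
      then show ?thesis
        using \<open>e > 0\<close> by (simp add: dist_norm power2_less_imp_less)
    qed
    then show "\<exists>N. \<forall>m\<ge>N. \<forall>n\<ge>N. dist (s m) (s n) < e"
      by blast
  qed
  then obtain y where y: "s \<longlonglongrightarrow> y"
    using Cauchy_convergent_iff convergent_def by blast
  have "y \<in> M"
    using closed_sequentially[OF assms(2) _ y] s(1) by blast
  moreover have "(\<lambda>n. norm (x - s n)) \<longlonglongrightarrow> norm (x - y)"
    by (intro tendsto_intros y)
  then have "norm (x - y) = d"
    using lim LIMSEQ_unique by blast
  ultimately show ?thesis
    using that d_le by auto
qed

lemma csubspace_imp_subspace: "csubspace M \<Longrightarrow> subspace M"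
  unfolding subspace_def scaleR_scaleC
  by (metis complex_vector.subspace_0 complex_vector.subspace_add complex_vector.subspace_scale)

lemma orth_proj_ex1:
  fixes M :: "'a::complex_hilbert_space set"
  assumes "csubspace M" "closed M"
  shows "\<exists>!y. y \<in> M \<and> (\<forall>m\<in>M. cinner (x - y) m = 0)"
proof (rule ex_ex1I)
  obtain y where y: "y \<in> M" "\<And>m. m \<in> M \<Longrightarrow> norm (x - y) \<le> norm (x - m)"
    using closest_point_in_closed_subspace[OF csubspace_imp_subspace[OF assms(1)] assms(2)] by metis
  have "cinner (x - y) m = 0" if m: "m \<in> M" for m
  proof (rule ccontr)
    assume ne: "cinner (x - y) m \<noteq> 0"
    then have m0: "norm m > 0" by auto
    \<comment> \<open>Moving from \<open>y\<close> to the projection onto the line through \<open>m\<close> would reduce the distance.\<close>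
    define c where "c = cinner (x - y) m / cinner m m"
    have cc: "c * cinner m m = cinner (x - y) m"
      using m0 by (simp add: c_def cinner_self)
    have "y + c *\<^sub>C m \<in> M"
      using y(1) m assms(1) by (intro complex_vector.subspace_add complex_vector.subspace_scale)
    from y(2)[OF this] have "(norm (x - y))\<^sup>2 \<le> (norm ((x - y) - c *\<^sub>C m))\<^sup>2"
      by (simp add: diff_diff_eq power_mono)
    moreover have "complex_of_real ((norm ((x - y) - c *\<^sub>C m))\<^sup>2)
        = complex_of_real ((norm (x - y))\<^sup>2 - (cmod c)\<^sup>2 * (norm m)\<^sup>2)"
    proof -
      have cc': "cinner m (x - y) = cnj c * cinner m m"
        using cc by (metis cinner_commute complex_cnj_mult)
      have "cinner (v - c *\<^sub>C m) (v - c *\<^sub>C m) = cinner v v - c * cnj c * cinner m m"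
        if "cinner v m = c * cinner m m" "cinner m v = cnj c * cinner m m" for v
        using that by (simp add: cinner.diff_left cinner.diff_right cinner_scaleC_left
            cinner_scaleC_right algebra_simps)
      from this[OF cc[symmetric] cc'] show ?thesis
        by (simp only: cinner_self of_real_diff of_real_mult complex_norm_square)
    qed
    then have "(norm ((x - y) - c *\<^sub>C m))\<^sup>2 = (norm (x - y))\<^sup>2 - (cmod c)\<^sup>2 * (norm m)\<^sup>2"
      by (simp only: of_real_eq_iff)
    ultimately have "(cmod c)\<^sup>2 * (norm m)\<^sup>2 \<le> 0" by simp
    moreover have "(cmod c)\<^sup>2 * (norm m)\<^sup>2 > 0"
      using ne m0 cc by (intro mult_pos_pos) auto
    ultimately show False by simp
  qed
  with y(1) show "\<exists>y. y \<in> M \<and> (\<forall>m\<in>M. cinner (x - y) m = 0)" by blast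
next
  fix y z
  assume y: "y \<in> M \<and> (\<forall>m\<in>M. cinner (x - y) m = 0)"
    and z: "z \<in> M \<and> (\<forall>m\<in>M. cinner (x - z) m = 0)"
  then have "z - y \<in> M"
    using assms(1) by (auto intro: complex_vector.subspace_diff)
  then have "cinner (x - y) (z - y) - cinner (x - z) (z - y) = 0"
    using y z by simp
  then have "cinner (z - y) (z - y) = 0"
    by (simp add: cinner.diff_left algebra_simps)
  then show "y = z"
    by (simp add: cinner_self)
qed

lemma
  fixes M :: "'a::complex_hilbert_space set"
  assumes "csubspace M" "closed M"
  shows orth_proj_in: "orth_proj M x \<in> M"
    and orth_proj_orth: "m \<in> M \<Longrightarrow> cinner (x - orth_proj M x) m = 0"
  using theI'[OF orth_proj_ex1[OF assms, of x]] unfolding orth_proj_def by auto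

lemma orth_proj_eqI:
  fixes M :: "'a::complex_hilbert_space set"
  assumes "csubspace M" "closed M" "y \<in> M" "\<And>m. m \<in> M \<Longrightarrow> cinner (x - y) m = 0"
  shows "orth_proj M x = y"
  unfolding orth_proj_def using assms(3,4) orth_proj_ex1[OF assms(1,2), of x]
  by (intro the1_equality) auto

lemma orth_proj_idem:
  fixes M :: "'a::complex_hilbert_space set"
  assumes "csubspace M" "closed M" "x \<in> M"
  shows "orth_proj M x = x"
  by (rule orth_proj_eqI) (use assms in \<open>auto simp: cinner.zero_left\<close>)

lemma orth_proj_self_adjoint:
  fixes M :: "'a::complex_hilbert_space set"
  assumes "csubspace M" "closed M"
  shows "cinner (orth_proj M x) y = cinner x (orth_proj M y)"
proof -
  have "cinner (orth_proj M x) y = cinner (orth_proj M x) (orth_proj M y)"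
    using orth_proj_orth[OF assms orth_proj_in[OF assms], of y x]
    by (metis cinner.diff_left cinner_commute eq_iff_diff_eq_0)
  also have "\<dots> = cinner x (orth_proj M y)"
    using orth_proj_orth[OF assms orth_proj_in[OF assms], of x y]
    by (simp add: cinner.diff_left)
  finally show ?thesis .
qed

lemma norm_orth_proj_le:
  fixes M :: "'a::complex_hilbert_space set"
  assumes "csubspace M" "closed M"
  shows "norm (orth_proj M x) \<le> norm x"
proof (cases "norm (orth_proj M x) = 0")
  case False
  have "cinner (orth_proj M x) (orth_proj M x) = cinner x (orth_proj M x)"
    using orth_proj_orth[OF assms orth_proj_in[OF assms], of x x] by (simp add: cinner.diff_left)
  then have "norm (orth_proj M x) * norm (orth_proj M x) = cmod (cinner x (orth_proj M x))"
    by (metis cinner_self norm_of_real abs_power2 power2_eq_square real_norm_def)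
  also have "\<dots> \<le> norm x * norm (orth_proj M x)"
    by (rule norm_cinner_le)
  finally show ?thesis
    using False by simp
qed simp

lemma bounded_clinear_orth_proj:
  fixes M :: "'a::complex_hilbert_space set"
  assumes "csubspace M" "closed M"
  shows "bounded_clinear (orth_proj M)"
proof -
  note in_M = orth_proj_in[OF assms] and orth = orth_proj_orth[OF assms]
  have add: "orth_proj M (x + y) = orth_proj M x + orth_proj M y" for x y
  proof (rule orth_proj_eqI[OF assms])
    show "orth_proj M x + orth_proj M y \<in> M"
      using assms(1) in_M by (intro complex_vector.subspace_add)
    fix m assume "m \<in> M"
    with orth[of m x] orth[of m y]
    show "cinner (x + y - (orth_proj M x + orth_proj M y)) m = 0"
      by (simp add: cinner.diff_left cinner_add_left)
  qed
  have scale: "orth_proj M (c *\<^sub>C x) = c *\<^sub>C orth_proj M x" for c x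
  proof (rule orth_proj_eqI[OF assms])
    show "c *\<^sub>C orth_proj M x \<in> M"
      using assms(1) in_M by (intro complex_vector.subspace_scale)
    fix m assume "m \<in> M"
    with orth[of m x] show "cinner (c *\<^sub>C x - c *\<^sub>C orth_proj M x) m = 0"
      by (simp add: cinner.diff_left cinner_scaleC_left)
  qed
  have "bounded_linear (orth_proj M)"
    by (rule bounded_linear_intro[of _ 1])
       (simp_all add: add scaleR_scaleC scale norm_orth_proj_le[OF assms])
  with scale show ?thesis
    by (simp add: bounded_clinear_def)
qed

section \<open>Approximate eigenvalues\<close>

definition approx_eigenvalue :: "('a::complex_inner \<Rightarrow> 'a) \<Rightarrow> complex \<Rightarrow> bool"
  where "approx_eigenvalue T z \<longleftrightarrow>
    (\<exists>x. (\<forall>n::nat. norm (x n) = 1) \<and> (\<lambda>n. T (x n) - z *\<^sub>C x n) \<longlonglongrightarrow> 0)"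

lemma bounded_linear_diff_scaleC:
  "bounded_clinear T \<Longrightarrow> bounded_linear (\<lambda>x. T x - z *\<^sub>C x)"
  by (intro bounded_linear_sub bounded_clinear_linear scaleC.bounded_linear_right)

lemma bounded_below_if_not_approx_eigenvalue:
  fixes T :: "'a::complex_inner \<Rightarrow> 'a"
  assumes T: "bounded_clinear T" and "\<not> approx_eigenvalue T z"
  obtains c where "c > 0" "\<And>x. c * norm x \<le> norm (T x - z *\<^sub>C x)"
proof (rule ccontr)
  assume neg: "\<not> thesis"
  interpret B: bounded_linear "\<lambda>x. T x - z *\<^sub>C x"
    by (rule bounded_linear_diff_scaleC[OF T])
  have "\<exists>x. norm x = 1 \<and> norm (T x - z *\<^sub>C x) < inverse (real (Suc n))" for n
  proof -
    have "\<not> (\<forall>x. inverse (real (Suc n)) * norm x \<le> norm (T x - z *\<^sub>C x))"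
      using neg that[of "inverse (real (Suc n))"] by (metis inverse_positive_iff_positive of_nat_0_less_iff zero_less_Suc)
    then obtain x where x: "norm (T x - z *\<^sub>C x) < inverse (real (Suc n)) * norm x"
      by (auto simp: not_le)
    then have "norm x > 0"
      by (cases "x = 0") (auto simp: B.zero)
    moreover have "norm (T (x /\<^sub>R norm x) - z *\<^sub>C (x /\<^sub>R norm x)) < inverse (real (Suc n))"
      using x \<open>norm x > 0\<close> by (simp only: B.scaleR norm_scaleR) (simp add: divide_simps mult.commute)
    ultimately show ?thesis
      by (intro exI[of _ "x /\<^sub>R norm x"]) simp
  qed
  then obtain x where x: "\<And>n. norm (x n) = 1"
    "\<And>n. norm (T (x n) - z *\<^sub>C x n) < inverse (real (Suc n))"
    by metis
  have "(\<lambda>n. T (x n) - z *\<^sub>C x n) \<longlonglongrightarrow> 0"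
    by (rule Lim_null_comparison[OF _ LIMSEQ_inverse_real_of_nat])
       (use less_imp_le[OF x(2)] in auto)
  with x(1) assms(2) show False
    unfolding approx_eigenvalue_def by blast
qed

lemma approx_eigenvalueI:
  fixes T :: "'a::complex_inner \<Rightarrow> 'a"
  assumes T: "bounded_clinear T" and lim: "(\<lambda>n. T (y n) - z *\<^sub>C y n) \<longlonglongrightarrow> 0"
    and ne: "\<not> y \<longlonglongrightarrow> 0"
  shows "approx_eigenvalue T z"
proof (rule ccontr)
  assume "\<not> ?thesis"
  then obtain c where c: "c > 0" "\<And>x. c * norm x \<le> norm (T x - z *\<^sub>C x)"
    using bounded_below_if_not_approx_eigenvalue[OF T] by metis
  have "y \<longlonglongrightarrow> 0"
  proof (rule Lim_null_comparison)
    show "eventually (\<lambda>n. norm (y n) \<le> norm (T (y n) - z *\<^sub>C y n) / c) sequentially"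
      using c by (simp add: pos_le_divide_eq mult.commute)
    show "(\<lambda>n. norm (T (y n) - z *\<^sub>C y n) / c) \<longlonglongrightarrow> 0"
      using tendsto_divide[OF tendsto_norm[OF lim] tendsto_const[of c]] c(1) by simp
  qed
  with ne show False ..
qed

lemma approx_eigenvalue_in_spectrum:
  fixes T :: "'a::complex_inner \<Rightarrow> 'a"
  assumes "approx_eigenvalue T z"
  shows "z \<in> spectrum T"
proof (rule ccontr)
  assume "z \<notin> spectrum T"
  then obtain S where S: "bounded_clinear S" "\<And>x. S (z *\<^sub>C x - T x) = x"
    by (auto simp: spectrum_def)
  interpret S: bounded_linear S
    by (rule bounded_clinear_linear[OF S(1)])
  obtain x where x: "\<And>n::nat. norm (x n) = 1" "(\<lambda>n. T (x n) - z *\<^sub>C x n) \<longlonglongrightarrow> 0"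
    using assms by (auto simp: approx_eigenvalue_def)
  have "(\<lambda>n. S (z *\<^sub>C x n - T (x n))) \<longlonglongrightarrow> S (- 0)"
    using S.tendsto[OF tendsto_minus[OF x(2)]] by simp
  then have "x \<longlonglongrightarrow> 0"
    by (simp add: S S.zero)
  then have "(\<lambda>n. norm (x n)) \<longlonglongrightarrow> 0"
    by (rule tendsto_norm_zero)
  then show False
    by (simp add: x(1) LIMSEQ_const_iff)
qed

text \<open>
  If \<open>T - z\<close> is bounded below, its range is closed. A vector \<open>v\<close> orthogonal to that range
  satisfies \<open>T v = cnj z v\<close>; since \<open>\<langle>T v, v\<rangle>\<close> is real, either \<open>v = 0\<close> or \<open>z\<close> is
  real, and then \<open>v\<close> lies in the kernel of \<open>T - z\<close>, which is trivial. So \<open>T - z\<close> is onto.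
\<close>

lemma self_adjoint_inverse:
  fixes T :: "'a::complex_hilbert_space \<Rightarrow> 'a"
  assumes T: "bounded_clinear T" and adj: "\<And>x y. cinner (T x) y = cinner x (T y)"
    and nev: "\<not> approx_eigenvalue T z"
  obtains S where "bounded_clinear S" "\<And>x. S (z *\<^sub>C x - T x) = x" "\<And>x. z *\<^sub>C S x - T (S x) = x"
proof -
  obtain c where c: "c > 0" "\<And>x. c * norm x \<le> norm (T x - z *\<^sub>C x)"
    using bounded_below_if_not_approx_eigenvalue[OF T nev] by metis
  define B where "B = (\<lambda>x. T x - z *\<^sub>C x)"
  interpret B: bounded_linear B
    unfolding B_def by (rule bounded_linear_diff_scaleC[OF T])
  have Bs: "B (a *\<^sub>C x) = a *\<^sub>C B x" for a x
    by (simp add: B_def bounded_clinear_scaleC[OF T] scaleC.diff_right scaleC_scaleC mult.commute)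
  have below: "c * norm x \<le> norm (B x)" for x
    using c(2) by (simp add: B_def)
  have ker: "x = 0" if "B x = 0" for x
    using below[of x] c(1) that by (simp add: mult_le_0_iff)
  have "complete (range B)"
    by (rule complete_isometric_image[of c])
       (use c(1) below in \<open>simp_all add: B.bounded_linear_axioms complete_UNIV\<close>)
  then have cl: "closed (range B)"
    by (rule complete_imp_closed)
  have sub: "csubspace (range B)"
    by (rule complex_vector.subspaceI)
       (auto simp: B.add[symmetric] Bs[symmetric] intro: range_eqI[where x = 0] B.zero[symmetric])
  have onto: "y \<in> range B" for y
  proof -
    define v where "v = y - orth_proj (range B) y"
    have "cinner (T v - cnj z *\<^sub>C v) w = cinner v (B w)" for w
      by (simp add: B_def cinner.diff_left cinner.diff_right adj cinner_scaleC_left cinner_scaleC_right)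
    then have "cinner (T v - cnj z *\<^sub>C v) w = 0" for w
      using orth_proj_orth[OF sub cl, of "B w" y] by (simp add: v_def)
    from this[of "T v - cnj z *\<^sub>C v"] have Tv: "T v = cnj z *\<^sub>C v"
      by (simp add: cinner_self)
    have "v = 0"
    proof (rule ccontr)
      assume "v \<noteq> 0"
      have "cnj z * cinner v v = z * cinner v v"
        using adj[of v v] by (simp add: Tv cinner_scaleC_left cinner_scaleC_right)
      then have "cnj z = z"
        using \<open>v \<noteq> 0\<close> by (simp add: cinner_self)
      then have "B v = 0"
        by (simp add: B_def Tv)
      with ker \<open>v \<noteq> 0\<close> show False by blast
    qed
    then show ?thesis
      using orth_proj_in[OF sub cl, of y] by (simp add: v_def)
  qed
  define S where "S y = (SOME x. B x = - y)" for y
  have BS: "B (S y) = - y" for y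
    using onto[of "- y"] unfolding S_def by (metis (mono_tags, lifting) image_iff someI_ex)
  have SB: "S y = x" if "B x = - y" for x y
    using ker[of "S y - x"] BS[of y] that by (simp add: B.diff)
  have "bounded_linear S"
  proof (rule bounded_linear_intro[of _ "1 / c"])
    show "norm (S x) \<le> norm x * (1 / c)" for x
      using below[of "S x"] c(1) by (simp add: BS field_simps)
  qed (auto intro!: SB simp: B.add B.scaleR BS)
  moreover have "S (a *\<^sub>C x) = a *\<^sub>C S x" for a x
    by (rule SB) (simp add: Bs BS scaleC.minus_right)
  moreover have "S (z *\<^sub>C x - T x) = x" for x
    by (rule SB) (simp add: B_def)
  moreover have "z *\<^sub>C S x - T (S x) = x" for x
    using BS[of x] by (simp add: B_def algebra_simps)
  ultimately show ?thesis
    using that[of S] by (simp add: bounded_clinear_def)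
qed

section \<open>The spectrum of a product of two projections\<close>

locale two_closed_subspaces =
  fixes M1 M2 :: "'a::complex_hilbert_space set"
  assumes sub1: "csubspace M1" and cl1: "closed M1"
    and sub2: "csubspace M2" and cl2: "closed M2"
begin

abbreviation P :: "'a \<Rightarrow> 'a" where "P \<equiv> orth_proj M1"
abbreviation Q :: "'a \<Rightarrow> 'a" where "Q \<equiv> orth_proj M2"

text \<open>
  The compression \<open>D\<close> of \<open>Q\<close> to \<open>M1\<close> is self-adjoint and has the same nonzero spectrum as
  \<open>Q \<circ> P\<close>.
\<close>

definition D :: "'a \<Rightarrow> 'a" where "D x = P (Q (P x))"

sublocale P: bounded_linear P
  by (rule bounded_clinear_linear[OF bounded_clinear_orth_proj[OF sub1 cl1]])

sublocale Q: bounded_linear Q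
  by (rule bounded_clinear_linear[OF bounded_clinear_orth_proj[OF sub2 cl2]])

lemma P_scaleC: "P (c *\<^sub>C x) = c *\<^sub>C P x"
  by (rule bounded_clinear_scaleC[OF bounded_clinear_orth_proj[OF sub1 cl1]])

lemma Q_scaleC: "Q (c *\<^sub>C x) = c *\<^sub>C Q x"
  by (rule bounded_clinear_scaleC[OF bounded_clinear_orth_proj[OF sub2 cl2]])

lemma P_idem [simp]: "P (P x) = P x"
  by (rule orth_proj_idem[OF sub1 cl1 orth_proj_in[OF sub1 cl1]])

lemma Q_idem [simp]: "Q (Q x) = Q x"
  by (rule orth_proj_idem[OF sub2 cl2 orth_proj_in[OF sub2 cl2]])

lemma P_adj: "cinner (P x) y = cinner x (P y)"
  by (rule orth_proj_self_adjoint[OF sub1 cl1])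

lemma Q_adj: "cinner (Q x) y = cinner x (Q y)"
  by (rule orth_proj_self_adjoint[OF sub2 cl2])

lemma norm_P_le: "norm (P x) \<le> norm x"
  by (rule norm_orth_proj_le[OF sub1 cl1])

lemma norm_Q_le: "norm (Q x) \<le> norm x"
  by (rule norm_orth_proj_le[OF sub2 cl2])

lemma bounded_clinear_QP: "bounded_clinear (Q \<circ> P)"
  unfolding bounded_clinear_def o_def
  by (intro conjI bounded_linear_compose[OF Q.bounded_linear_axioms P.bounded_linear_axioms])
     (simp add: P_scaleC Q_scaleC)

lemma bounded_clinear_D: "bounded_clinear D"
  unfolding bounded_clinear_def D_def
  by (intro conjI bounded_linear_compose[OF P.bounded_linear_axioms]
        bounded_linear_compose[OF Q.bounded_linear_axioms P.bounded_linear_axioms])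
     (simp add: P_scaleC Q_scaleC)

lemma D_adj: "cinner (D x) y = cinner x (D y)"
  by (simp add: D_def P_adj Q_adj)

lemma cinner_D_self: "cinner (D x) x = complex_of_real ((norm (Q (P x)))\<^sup>2)"
  by (metis D_def P_adj Q_adj Q_idem cinner_self)

lemma approx_eigenvalue_D_real:
  assumes "approx_eigenvalue D z"
  obtains t where "z = complex_of_real t" "0 \<le> t" "t \<le> 1"
proof -
  obtain x where x: "\<And>n::nat. norm (x n) = 1" "(\<lambda>n. D (x n) - z *\<^sub>C x n) \<longlonglongrightarrow> 0"
    using assms by (auto simp: approx_eigenvalue_def)
  have "(\<lambda>n. cinner (D (x n) - z *\<^sub>C x n) (x n)) \<longlonglongrightarrow> 0"
  proof (rule Lim_null_comparison[OF _ tendsto_norm_zero[OF x(2)]])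
    show "eventually (\<lambda>n. norm (cinner (D (x n) - z *\<^sub>C x n) (x n)) \<le> norm (D (x n) - z *\<^sub>C x n)) sequentially"
      using norm_cinner_le[of "D (x n) - z *\<^sub>C x n" "x n" for n] by (simp add: x(1))
  qed
  then have "(\<lambda>n. complex_of_real ((norm (Q (P (x n))))\<^sup>2) - z) \<longlonglongrightarrow> 0"
    by (simp add: cinner.diff_left cinner_D_self cinner_scaleC_left cinner_self x(1))
  then have lim: "(\<lambda>n. complex_of_real ((norm (Q (P (x n))))\<^sup>2)) \<longlonglongrightarrow> z"
    by (simp only: LIM_zero_iff)
  have "norm (Q (P (x n))) \<le> 1" for n
    using norm_Q_le norm_P_le x(1) by (metis order_trans)
  then have "complex_of_real ((norm (Q (P (x n))))\<^sup>2) \<in> complex_of_real ` {0..1}" for n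
    by (intro imageI) (simp add: power_le_one)
  moreover have "closed (complex_of_real ` {0..1})"
    by (intro compact_imp_closed compact_continuous_image continuous_intros) simp
  ultimately have "z \<in> complex_of_real ` {0..1}"
    using closed_sequentially[OF _ _ lim] by blast
  then show ?thesis
    using that by auto
qed

text \<open>
  This is the relation between the spectra of \<open>AB\<close> and \<open>BA\<close> for \<open>A = Q \<circ> P\<close> and
  \<open>B = P\<close>: if \<open>R\<close> inverts \<open>z - BA\<close>, then \<open>(1 + A \<circ> R \<circ> B) / z\<close> inverts \<open>z - AB\<close>.
\<close>

lemma spectrum_QP_imp_approx_eigenvalue_D:
  assumes "z \<in> spectrum (Q \<circ> P)" "z \<noteq> 0"
  shows "approx_eigenvalue D z"
proof (rule ccontr)
  assume "\<not> ?thesis"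
  then obtain R where R: "bounded_clinear R" "\<And>x. R (z *\<^sub>C x - D x) = x"
    "\<And>x. z *\<^sub>C R x - D (R x) = x"
    using self_adjoint_inverse[OF bounded_clinear_D D_adj] by metis
  interpret R: bounded_linear R
    by (rule bounded_clinear_linear[OF R(1)])
  define S where "S x = inverse z *\<^sub>C (x + Q (P (R (P x))))" for x
  have "bounded_clinear S"
    unfolding bounded_clinear_def S_def
    by (intro conjI bounded_linear_compose[OF scaleC.bounded_linear_right] bounded_linear_add
        bounded_linear_ident bounded_linear_compose[OF P.bounded_linear_axioms]
        bounded_linear_compose[OF Q.bounded_linear_axioms]
        bounded_linear_compose[OF R.bounded_linear_axioms] P.bounded_linear_axioms)
      (simp add: P_scaleC Q_scaleC bounded_clinear_scaleC[OF R(1)] scaleC_add_right scaleC_scaleC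
        mult.commute)
  moreover have "S (z *\<^sub>C x - (Q \<circ> P) x) = x" for x
  proof -
    have "P (z *\<^sub>C x - Q (P x)) = z *\<^sub>C P x - D (P x)"
      by (simp add: P.diff P_scaleC D_def)
    then show ?thesis
      using assms(2) by (simp add: S_def R(2) scaleC_scaleC)
  qed
  moreover have "z *\<^sub>C S x - (Q \<circ> P) (S x) = x" for x
  proof -
    define w where "w = R (P x)"
    have Dw: "D w = z *\<^sub>C w - P x"
      using R(3)[of "P x"] by (simp add: w_def algebra_simps)
    then have "z *\<^sub>C w = D w + P x" by simp
    then have "P (z *\<^sub>C w) = z *\<^sub>C w"
      by (simp add: P.add D_def)
    then have Pw: "P w = w"
      using assms(2) by (simp add: P_scaleC)
    have "Q (P (Q (P w))) = Q (z *\<^sub>C w - P x)"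
      using Dw by (simp add: D_def)
    then have "Q (P (x + Q (P w))) = z *\<^sub>C Q w"
      by (simp add: P.add Q.add Q.diff Q_scaleC)
    then show ?thesis
      using assms(2) by (simp add: S_def P_scaleC Q_scaleC scaleC_scaleC Pw flip: w_def)
  qed
  ultimately have "z \<notin> spectrum (Q \<circ> P)"
    by (auto simp: spectrum_def)
  with assms(1) show False by simp
qed

lemma approx_eigenvalue_D_imp_spectrum_QP:
  assumes "approx_eigenvalue D z" "z \<noteq> 0"
  shows "z \<in> spectrum (Q \<circ> P)"
proof -
  obtain x where x: "\<And>n::nat. norm (x n) = 1" "(\<lambda>n. D (x n) - z *\<^sub>C x n) \<longlonglongrightarrow> 0"
    using assms by (auto simp: approx_eigenvalue_def)
  have "approx_eigenvalue (Q \<circ> P) z"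
  proof (rule approx_eigenvalueI[OF bounded_clinear_QP, of "\<lambda>n. Q (P (x n))"])
    show "(\<lambda>n. (Q \<circ> P) (Q (P (x n))) - z *\<^sub>C Q (P (x n))) \<longlonglongrightarrow> 0"
      using Q.tendsto[OF P.tendsto[OF x(2)]]
      by (simp add: Q.diff P.diff D_def P_scaleC Q_scaleC Q.zero P.zero)
    show "\<not> (\<lambda>n. Q (P (x n))) \<longlonglongrightarrow> 0"
    proof
      assume "(\<lambda>n. Q (P (x n))) \<longlonglongrightarrow> 0"
      then have "(\<lambda>n. D (x n)) \<longlonglongrightarrow> 0"
        unfolding D_def using P.tendsto P.zero by fastforce
      from tendsto_diff[OF this x(2)] have "(\<lambda>n. z *\<^sub>C x n) \<longlonglongrightarrow> 0"
        by simp
      from tendsto_norm_zero[OF this] have "(\<lambda>n::nat. cmod z) \<longlonglongrightarrow> 0"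
        by (simp add: norm_scaleC x(1))
      with assms(2) show False
        by (simp add: LIMSEQ_const_iff)
    qed
  qed
  then show ?thesis
    by (rule approx_eigenvalue_in_spectrum)
qed

lemma zero_in_spectrum_QP:
  assumes "M1 \<noteq> UNIV \<or> M2 \<noteq> UNIV"
  shows "0 \<in> spectrum (Q \<circ> P)"
proof (rule ccontr)
  assume "0 \<notin> spectrum (Q \<circ> P)"
  then obtain S where S: "bounded_clinear S" "\<And>x. S (- Q (P x)) = x" "\<And>x. - Q (P (S x)) = x"
    by (auto simp: spectrum_def)
  from assms show False
  proof
    assume "M1 \<noteq> UNIV"
    then obtain x where "x \<notin> M1" by blast
    have "P (x - P x) = 0"
      by (simp add: P.diff)
    then have "x - P x = P x - P x"
      using S(2)[of "x - P x"] S(2)[of 0] by (simp add: P.zero)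
    then have "P x = x" by simp
    with orth_proj_in[OF sub1 cl1, of x] \<open>x \<notin> M1\<close> show False by simp
  next
    assume "M2 \<noteq> UNIV"
    then obtain x where "x \<notin> M2" by blast
    moreover have "x \<in> M2"
      using S(3)[of x] orth_proj_in[OF sub2 cl2, of "P (S x)"] sub2
      by (metis complex_vector.subspace_neg)
    ultimately show False by simp
  qed
qed

end

section \<open>Convexity of the numerical range\<close>

lemma numerical_rangeI:
  fixes T :: "'a::complex_inner \<Rightarrow> 'a"
  assumes "bounded_clinear T" "x \<noteq> 0"
  shows "cinner (T x) x / complex_of_real ((norm x)\<^sup>2) \<in> numerical_range T"
proof -
  define y where "y = complex_of_real (inverse (norm x)) *\<^sub>C x"
  have "norm y = 1"
    using assms(2) by (simp add: y_def norm_scaleC norm_inverse)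
  moreover have "cinner (T y) y = cinner (T x) x / complex_of_real ((norm x)\<^sup>2)"
    by (simp add: y_def bounded_clinear_scaleC[OF assms(1)] cinner_scaleC_left cinner_scaleC_right
        divide_simps power2_eq_square)
  ultimately show ?thesis
    unfolding numerical_range_def by force
qed

lemma closure_numerical_rangeI:
  fixes T :: "'a::complex_inner \<Rightarrow> 'a" and x :: "nat \<Rightarrow> 'a"
  assumes T: "bounded_clinear T" and norm: "(\<lambda>n. cinner (x n) (x n)) \<longlonglongrightarrow> 1"
    and lim: "(\<lambda>n. cinner (T (x n)) (x n)) \<longlonglongrightarrow> w"
  shows "w \<in> closure (numerical_range T)"
proof (rule Lim_in_closed_set)
  have "eventually (\<lambda>n. cinner (x n) (x n) \<noteq> 0) sequentially"
    by (rule tendsto_imp_eventually_ne[OF norm]) simp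
  then show "eventually (\<lambda>n. cinner (T (x n)) (x n) / cinner (x n) (x n)
      \<in> closure (numerical_range T)) sequentially"
  proof eventually_elim
    case (elim n)
    then have "x n \<noteq> 0" by auto
    from numerical_rangeI[OF T this] closure_subset show ?case
      by (auto simp only: cinner_self)
  qed
  show "(\<lambda>n. cinner (T (x n)) (x n) / cinner (x n) (x n)) \<longlonglongrightarrow> w"
    using tendsto_divide[OF lim norm] by simp
qed simp_all

text \<open>
  The Toeplitz-Hausdorff theorem. After an affine normalisation the form \<open>F\<close> takes the
  values \<open>0\<close> and \<open>1\<close> at the two given vectors; a suitable phase makes \<open>F\<close> real along the
  segment between them, and the intermediate value theorem applies.
\<close>

theorem convex_numerical_range:
  fixes T :: "'a::complex_inner \<Rightarrow> 'a"
  assumes T: "bounded_clinear T"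
  shows "convex (numerical_range T)"
proof (rule convexI)
  fix a b :: complex and s u :: real
  assume a: "a \<in> numerical_range T" and b: "b \<in> numerical_range T"
    and su: "0 \<le> s" "0 \<le> u" "s + u = 1"
  obtain x y where x: "norm x = 1" "a = cinner (T x) x" and y: "norm y = 1" "b = cinner (T y) y"
    using a b by (auto simp: numerical_range_def)
  show "s *\<^sub>R a + u *\<^sub>R b \<in> numerical_range T"
  proof (cases "a = b")
    case True
    then show ?thesis
      using a su by (simp flip: scaleR_left_distrib)
  next
    case False
    interpret T: bounded_linear T
      by (rule bounded_clinear_linear[OF T])
    define F where "F v w = (cinner (T v) w - a * cinner v w) / (b - a)" for v w
    have F_add: "F (v + v') w = F v w + F v' w" "F w (v + v') = F w v + F w v'" for v v' w
      by (simp_all add: F_def T.add cinner_add_left cinner_add_right algebra_simps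
          flip: add_divide_distrib)
    have F_scale: "F (c *\<^sub>C v) w = c * F v w" "F w (c *\<^sub>C v) = cnj c * F w v" for c v w
      by (simp_all add: F_def bounded_clinear_scaleC[OF T] cinner_scaleC_left cinner_scaleC_right
          algebra_simps)
    have Fx: "F x x = 0"
      by (simp add: F_def x cinner_self flip: x(2))
    have Fy: "F y y = 1"
      using False by (simp add: F_def y cinner_self flip: y(2))
    \<comment> \<open>The phase \<open>c\<close> makes \<open>c * F x y + cnj c * F y x\<close> real.\<close>
    define d where "d = F x y - cnj (F y x)"
    define c where "c = (if d = 0 then 1 else cnj (sgn d))"
    have norm_c: "cmod c = 1"
      by (simp add: c_def norm_sgn)
    define x' where "x' = c *\<^sub>C x"
    have x': "norm x' = 1" "F x' x' = 0"
      by (simp_all add: x'_def norm_scaleC norm_c x(1) F_scale Fx)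
    have "c * d = complex_of_real (cmod d)"
      by (simp add: c_def sgn_div_norm scaleR_conv_of_real divide_simps mult.commute[of "cnj _"])
         (simp add: power2_eq_square flip: complex_norm_square)
    then have "Im (c * d) = 0" by simp
    then have real: "Im (F x' y + F y x') = 0"
      by (simp add: x'_def F_scale d_def algebra_simps)
    define v where "v t = complex_of_real (1 - t) *\<^sub>C x' + complex_of_real t *\<^sub>C y" for t
    have Fv: "F (v t) (v t) = complex_of_real (t * t + t * (1 - t) * Re (F x' y + F y x'))" for t
    proof -
      have "F (complex_of_real r *\<^sub>C x' + complex_of_real t *\<^sub>C y)
          (complex_of_real r *\<^sub>C x' + complex_of_real t *\<^sub>C y)
          = complex_of_real (t * t) + complex_of_real (t * r) * (F x' y + F y x')" for r
        by (simp add: F_add F_scale x' Fy algebra_simps)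
      then have "F (v t) (v t) = complex_of_real (t * t)
          + complex_of_real (t * (1 - t)) * (F x' y + F y x')"
        unfolding v_def .
      also have "F x' y + F y x' = complex_of_real (Re (F x' y + F y x'))"
        using real by (simp add: complex_eq_iff)
      finally show ?thesis by simp
    qed
    define g where "g t = t * t + t * (1 - t) * Re (F x' y + F y x') - u * (norm (v t))\<^sup>2" for t
    have "\<exists>t. 0 \<le> t \<and> t \<le> 1 \<and> g t = 0"
    proof (rule IVT')
      show "g 0 \<le> 0"
        using su by (simp add: g_def v_def)
      show "0 \<le> g 1"
        using su by (simp add: g_def v_def y(1))
      show "continuous_on {0..1} g"
        unfolding g_def v_def
        by (intro continuous_intros scaleC.continuous_on)
    qed simp
    then obtain t where t: "0 \<le> t" "t \<le> 1" "g t = 0" by blast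
    have "v t \<noteq> 0"
    proof
      assume v0: "v t = 0"
      then have eq: "complex_of_real t *\<^sub>C y = complex_of_real (t - 1) *\<^sub>C x'"
        by (simp add: v_def scaleC.diff_left algebra_simps eq_neg_iff_add_eq_0)
      then have "\<bar>t\<bar> = \<bar>t - 1\<bar>"
        by (metis norm_scaleC x'(1) y(1) mult.right_neutral norm_of_real)
      then have "t \<noteq> 0" by auto
      have "F (complex_of_real t *\<^sub>C y) (complex_of_real t *\<^sub>C y) = 0"
        unfolding eq by (simp add: F_scale x')
      with \<open>t \<noteq> 0\<close> show False
        by (simp add: F_scale Fy)
    qed
    have "F (v t) (v t) = complex_of_real (u * (norm (v t))\<^sup>2)"
      using t(3) by (simp only: Fv g_def of_real_eq_iff)
    then have "cinner (T (v t)) (v t) = (a + u * (b - a)) * complex_of_real ((norm (v t))\<^sup>2)"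
      using False by (simp add: F_def cinner_self field_simps)
    then have "cinner (T (v t)) (v t) / complex_of_real ((norm (v t))\<^sup>2) = a + u * (b - a)"
      using \<open>v t \<noteq> 0\<close> by simp
    also have "\<dots> = s *\<^sub>R a + u *\<^sub>R b"
    proof -
      have s: "s = 1 - u" using su by simp
      show ?thesis unfolding s by (simp add: scaleR_conv_of_real algebra_simps)
    qed
    finally show ?thesis
      using numerical_rangeI[OF T \<open>v t \<noteq> 0\<close>] by simp
  qed
qed

section \<open>Elliptic domains inside the closed numerical range\<close>

text \<open>
  The Hopf map from unit vectors in \<open>\<complex>\<^sup>2\<close> to the unit sphere in \<open>\<real>\<^sup>3\<close> is onto.
\<close>

lemma sphere_parametrization:
  fixes p q r :: real
  assumes "p\<^sup>2 + q\<^sup>2 + r\<^sup>2 = 1"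
  obtains a b :: complex where "(cmod a)\<^sup>2 = (1 + p) / 2" "(cmod b)\<^sup>2 = (1 - p) / 2"
    "a * cnj b = Complex (q / 2) (r / 2)"
proof (cases "p = -1")
  case True
  then have "q\<^sup>2 + r\<^sup>2 = 0"
    using assms by simp
  then have "q = 0" "r = 0"
    by (auto simp: sum_power2_eq_zero_iff)
  with True that[of 0 1] show ?thesis
    by (simp add: complex_eq_iff)
next
  case False
  have "p\<^sup>2 \<le> 1"
    using assms by (smt (verit) zero_le_power2)
  then have "-1 < p"
    using False by (simp add: abs_square_le_1)
  define m where "m = sqrt ((1 + p) / 2)"
  have m: "m > 0" "m\<^sup>2 = (1 + p) / 2"
    using \<open>-1 < p\<close> by (simp_all add: m_def)
  have "(cmod (Complex (q / (2 * m)) (- r / (2 * m))))\<^sup>2 = (q\<^sup>2 + r\<^sup>2) / 4 / m\<^sup>2"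
    by (simp add: power_divide cmod_power2 power_mult_distrib add_divide_distrib)
  also have "q\<^sup>2 + r\<^sup>2 = (1 - p) * (1 + p)"
    using assms by (simp add: algebra_simps power2_eq_square)
  also have "(1 - p) * (1 + p) / 4 / m\<^sup>2 = (1 - p) / 2"
    using \<open>-1 < p\<close> by (simp add: m(2) field_simps)
  finally show ?thesis
    using m by (intro that[of "complex_of_real m" "Complex (q / (2 * m)) (- r / (2 * m))"])
      (simp_all add: complex_eq_iff)
qed

text \<open>
  For unit vectors \<open>(a, b)\<close> the right-hand sides form the numerical range of the matrix to
  which \<open>Q \<circ> P\<close> is asymptotically compressed. In the coordinates \<open>p, q, r\<close> of the unit
  sphere the right-hand side is an affine projection onto the plane. It covers the whole
  ellipse, already from the half of the sphere where the coordinate along the kernel of the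
  projection is nonnegative.
\<close>

lemma elliptic_domain_parametrization:
  assumes t: "0 < t" "t < 1" and w: "w \<in> elliptic_domain t"
  obtains a b :: complex where "(cmod a)\<^sup>2 + (cmod b)\<^sup>2 = 1"
    "w = complex_of_real t * (a * cnj a) + complex_of_real (sqrt (t * (1 - t))) * (a * cnj b)"
proof -
  define l k where "l = sqrt t" and "k = sqrt (1 - t)"
  have lk: "l > 0" "k > 0" "l\<^sup>2 = t" "k\<^sup>2 = 1 - t" "l\<^sup>2 + k\<^sup>2 = 1" "sqrt (t * (1 - t)) = l * k"
    using t by (simp_all add: l_def k_def real_sqrt_mult)
  define X where "X = Re w - t / 2"
  define A r where "A = 2 * X / l" and "r = 2 * Im w / (l * k)"
  have "A\<^sup>2 + r\<^sup>2 = X\<^sup>2 / (t / 4) + (Im w)\<^sup>2 / (t * (1 - t) / 4)"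
    using lk by (simp add: A_def r_def power_divide power_mult_distrib mult.commute)
  also have "\<dots> \<le> 1"
    using w t by (simp add: elliptic_domain_def X_def)
  finally have le: "A\<^sup>2 + r\<^sup>2 \<le> 1" .
  define B where "B = sqrt (1 - A\<^sup>2 - r\<^sup>2)"
  have B: "B\<^sup>2 = 1 - A\<^sup>2 - r\<^sup>2"
    using le by (simp add: B_def)
  \<comment> \<open>\<open>A\<close> and \<open>B\<close> are coordinates along the orthonormal vectors \<open>(l, k)\<close> and \<open>(- k, l)\<close>;
      the latter spans the kernel of \<open>(p, q) \<mapsto> t * p + l * k * q\<close>.\<close>
  define p q where "p = A * l - B * k" and "q = A * k + B * l"
  have "p\<^sup>2 + q\<^sup>2 = (A\<^sup>2 + B\<^sup>2) * (l\<^sup>2 + k\<^sup>2)"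
    by (simp add: p_def q_def power2_eq_square algebra_simps)
  then have "p\<^sup>2 + q\<^sup>2 + r\<^sup>2 = 1"
    by (simp add: lk B)
  then obtain a b where ab: "(cmod a)\<^sup>2 = (1 + p) / 2" "(cmod b)\<^sup>2 = (1 - p) / 2"
    "a * cnj b = Complex (q / 2) (r / 2)"
    using sphere_parametrization by metis
  have "t * p + l * k * q = A * l * (l\<^sup>2 + k\<^sup>2)"
    by (simp add: p_def q_def power2_eq_square algebra_simps flip: lk(3))
  also have "\<dots> = 2 * Re w - t"
    using lk by (simp add: A_def X_def)
  finally have re: "Re w = t * ((1 + p) / 2) + l * k * (q / 2)"
    by (simp add: field_simps)
  have im: "Im w = l * k * (r / 2)"
    using lk by (simp add: r_def)
  have "w = complex_of_real t * (a * cnj a) + complex_of_real (l * k) * (a * cnj b)"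
    unfolding ab(3) complex_norm_square[symmetric] of_real_power[symmetric] ab(1)
    using re im by (simp add: complex_eq_iff)
  moreover have "(cmod a)\<^sup>2 + (cmod b)\<^sup>2 = 1"
    by (simp add: ab field_simps)
  ultimately show ?thesis
    using that lk(6) by simp
qed

lemma cinner_tendsto_zero:
  fixes a b :: "nat \<Rightarrow> 'a::complex_inner"
  assumes a: "a \<longlonglongrightarrow> 0" and b: "\<And>n. norm (b n) \<le> c n" "c \<longlonglongrightarrow> l"
  shows "(\<lambda>n. cinner (a n) (b n)) \<longlonglongrightarrow> 0"
proof (rule Lim_null_comparison)
  show "eventually (\<lambda>n. norm (cinner (a n) (b n)) \<le> norm (a n) * c n) sequentially"
    by (intro always_eventually allI order_trans[OF norm_cinner_le] mult_left_mono b(1)) simp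
  show "(\<lambda>n. norm (a n) * c n) \<longlonglongrightarrow> 0"
    using tendsto_mult[OF tendsto_norm_zero[OF a] b(2)] by simp
qed

context two_closed_subspaces
begin

text \<open>
  Since \<open>t \<noteq> 0\<close> and \<open>D\<close> has values in \<open>M1\<close>, approximate eigenvectors of \<open>D\<close> are
  asymptotically in \<open>M1\<close>, so projecting them to \<open>M1\<close> keeps their norms close to \<open>1\<close>.
\<close>

lemma approx_eigenvectors_in_M1:
  assumes "approx_eigenvalue D (complex_of_real t)" "t \<noteq> 0"
  obtains u :: "nat \<Rightarrow> 'a" where "\<And>n. P (u n) = u n" "(\<lambda>n. norm (u n)) \<longlonglongrightarrow> 1"
    "(\<lambda>n. P (Q (u n)) - complex_of_real t *\<^sub>C u n) \<longlonglongrightarrow> 0"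
proof -
  obtain x where x: "\<And>n::nat. norm (x n) = 1" "(\<lambda>n. D (x n) - complex_of_real t *\<^sub>C x n) \<longlonglongrightarrow> 0"
    using assms by (auto simp: approx_eigenvalue_def)
  have lim: "(\<lambda>n. P (Q (P (x n))) - complex_of_real t *\<^sub>C P (x n)) \<longlonglongrightarrow> 0"
    using P.tendsto[OF x(2)] by (simp add: P.diff P_scaleC D_def P.zero)
  have "(\<lambda>n. complex_of_real t *\<^sub>C x n - complex_of_real t *\<^sub>C P (x n)) \<longlonglongrightarrow> 0"
    using tendsto_diff[OF lim x(2)] by (simp add: D_def)
  then have "(\<lambda>n. complex_of_real t *\<^sub>C (x n - P (x n))) \<longlonglongrightarrow> 0"
    by (simp only: scaleC.diff_right)
  then have "(\<lambda>n. complex_of_real (inverse t) *\<^sub>C complex_of_real t *\<^sub>C (x n - P (x n)))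
      \<longlonglongrightarrow> complex_of_real (inverse t) *\<^sub>C 0"
    by (rule bounded_linear.tendsto[OF scaleC.bounded_linear_right])
  then have diff: "(\<lambda>n. x n - P (x n)) \<longlonglongrightarrow> 0"
    using assms(2) by (simp add: scaleC_scaleC scaleC.zero_right)
  have "(\<lambda>n. norm (P (x n)) - norm (x n)) \<longlonglongrightarrow> 0"
    by (rule Lim_null_comparison[OF _ tendsto_norm_zero[OF diff]])
       (intro always_eventually allI, metis norm_minus_commute norm_triangle_ineq3 real_norm_def)
  then have "(\<lambda>n. norm (P (x n))) \<longlonglongrightarrow> 1"
    by (simp add: x(1) LIM_zero_iff)
  with lim show ?thesis
    by (intro that[of "\<lambda>n. P (x n)"]) simp_all
qed

text \<open>
  Let \<open>u\<close> be an approximate eigenvector of \<open>D\<close> in \<open>M1\<close> and \<open>v = Q u - t u\<close>. Then \<open>v\<close> is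
  asymptotically orthogonal to \<open>M1\<close> with squared norm \<open>t - t\<^sup>2\<close>, and \<open>Q v = (1 - t) Q u\<close>.
  Hence \<open>Q \<circ> P\<close> acts asymptotically on the span of \<open>u\<close> and \<open>v\<close> as a fixed
  two-dimensional matrix, whose quadratic form is evaluated at \<open>a u + g v\<close>.
\<close>

lemma two_dimensional_compression:
  fixes a g :: complex
  assumes ev: "approx_eigenvalue D (complex_of_real t)" "t \<noteq> 0"
    and unit: "(cmod a)\<^sup>2 + (cmod g)\<^sup>2 * (t - t\<^sup>2) = 1"
  shows "complex_of_real t * (a * cnj (a + g * complex_of_real (1 - t)))
    \<in> closure (numerical_range (Q \<circ> P))"
proof -
  let ?t = "complex_of_real t"
  obtain u where u: "\<And>n. P (u n) = u n" "(\<lambda>n. norm (u n)) \<longlonglongrightarrow> 1"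
    "(\<lambda>n. P (Q (u n)) - ?t *\<^sub>C u n) \<longlonglongrightarrow> 0"
    using approx_eigenvectors_in_M1[OF ev] by metis
  define e q where "e n = cinner (u n) (u n)" and "q n = cinner (Q (u n)) (u n)" for n
  have e: "e \<longlonglongrightarrow> 1"
    using tendsto_power[OF u(2), of 2, THEN tendsto_of_real[where 'a = complex]]
    unfolding e_def by (simp add: cinner_self)
  have "(\<lambda>n. cinner (P (Q (u n)) - ?t *\<^sub>C u n) (u n)) \<longlonglongrightarrow> 0"
    by (rule cinner_tendsto_zero[OF u(3) order_refl u(2)])
  then have "(\<lambda>n. q n - ?t * e n) \<longlonglongrightarrow> 0"
    by (simp add: cinner.diff_left P_adj u(1) cinner_scaleC_left q_def e_def)
  from tendsto_add[OF this tendsto_mult[OF tendsto_const[of ?t] e]] have q: "q \<longlonglongrightarrow> ?t"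
    by simp
  have q': "cinner (u n) (Q (u n)) = q n" "cinner (Q (u n)) (Q (u n)) = q n" for n
    by (simp_all add: q_def Q_adj)
  define z where "z n = a *\<^sub>C u n + g *\<^sub>C (Q (u n) - ?t *\<^sub>C u n)" for n
  define h where "h = a + g * complex_of_real (1 - t)"
  have zz: "cinner (z n) (z n) = a * cnj a * e n + (a * cnj g + g * cnj a) * (q n - ?t * e n)
      + g * cnj g * (q n - 2 * ?t * q n + ?t * ?t * e n)" for n
    by (simp add: z_def cinner_add_left cinner_add_right cinner.diff_left cinner.diff_right
        cinner_scaleC_left cinner_scaleC_right q' algebra_simps flip: e_def q_def)
  have "(\<lambda>n. cinner (z n) (z n)) \<longlonglongrightarrow> a * cnj a * 1 + (a * cnj g + g * cnj a) * (?t - ?t * 1)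
      + g * cnj g * (?t - 2 * ?t * ?t + ?t * ?t * 1)"
    unfolding zz by (intro tendsto_intros e q)
  also have "a * cnj a * 1 + (a * cnj g + g * cnj a) * (?t - ?t * 1)
      + g * cnj g * (?t - 2 * ?t * ?t + ?t * ?t * 1)
      = complex_of_real ((cmod a)\<^sup>2 + (cmod g)\<^sup>2 * (t - t\<^sup>2))"
    unfolding of_real_add of_real_mult of_real_diff complex_norm_square
    by (simp add: power2_eq_square algebra_simps)
  finally have norm: "(\<lambda>n. cinner (z n) (z n)) \<longlonglongrightarrow> 1"
    by (simp add: unit)
  define r where "r n = P (Q (u n)) - ?t *\<^sub>C u n" for n
  have Pz: "P (z n) = a *\<^sub>C u n + g *\<^sub>C (r n)" for n
    by (simp add: z_def r_def P.add P.diff P_scaleC u(1))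
  have Qz: "Q (z n) = h *\<^sub>C Q (u n)" for n
    by (simp add: z_def h_def Q.add Q.diff Q_scaleC scaleC.diff_right scaleC_scaleC
        scaleC_add_left scaleC.diff_left algebra_simps)
  have "(\<lambda>n. a * cnj h * q n + g * cnj h * cinner (r n) (Q (u n)))
      \<longlonglongrightarrow> a * cnj h * ?t + g * cnj h * 0"
    by (intro tendsto_intros q cinner_tendsto_zero[OF u(3)[folded r_def] norm_Q_le u(2)])
  moreover have "cinner ((Q \<circ> P) (z n)) (z n)
      = a * cnj h * q n + g * cnj h * cinner (r n) (Q (u n))" for n
    by (simp add: Q_adj Pz Qz cinner_add_left cinner_scaleC_left cinner_scaleC_right q' algebra_simps)
  ultimately have "(\<lambda>n. cinner ((Q \<circ> P) (z n)) (z n)) \<longlonglongrightarrow> ?t * (a * cnj h)"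
    by (simp add: mult_ac)
  from closure_numerical_rangeI[OF bounded_clinear_QP norm this] show ?thesis
    by (simp only: h_def)
qed

text \<open>
  The assumption is essential: for \<open>M1 = M2 = UNIV\<close> the product is the identity. Otherwise a
  nonzero vector orthogonal to \<open>M1\<close> or to \<open>M2\<close> gives the value \<open>0\<close>.
\<close>

lemma zero_in_numerical_range:
  assumes "M1 \<noteq> UNIV \<or> M2 \<noteq> UNIV"
  shows "0 \<in> numerical_range (Q \<circ> P)"
proof -
  have "\<exists>v. v \<noteq> 0 \<and> cinner (P v) (Q v) = 0"
    using assms
  proof
    assume "M1 \<noteq> UNIV"
    then obtain x where "x \<notin> M1" by blast
    then have "x - P x \<noteq> 0"
      using orth_proj_in[OF sub1 cl1, of x] by auto
    then show ?thesis
      by (intro exI[of _ "x - P x"]) (simp add: P.diff)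
  next
    assume "M2 \<noteq> UNIV"
    then obtain x where "x \<notin> M2" by blast
    then have "x - Q x \<noteq> 0"
      using orth_proj_in[OF sub2 cl2, of x] by auto
    then show ?thesis
      by (intro exI[of _ "x - Q x"]) (simp add: Q.diff)
  qed
  then obtain v where "v \<noteq> 0" "cinner ((Q \<circ> P) v) v = 0"
    by (auto simp: Q_adj)
  with numerical_rangeI[OF bounded_clinear_QP, of v] show ?thesis
    by simp
qed

lemma elliptic_domain_subset_closure_numerical_range:
  assumes "M1 \<noteq> UNIV \<or> M2 \<noteq> UNIV" and z: "z \<in> spectrum (Q \<circ> P)"
  shows "elliptic_domain (Re z) \<subseteq> closure (numerical_range (Q \<circ> P))" (is "_ \<subseteq> ?W")
proof -
  have zero: "0 \<in> ?W"
    using zero_in_numerical_range[OF assms(1)] closure_subset by blast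
  show ?thesis
  proof (cases "z = 0")
    case True
    with zero show ?thesis
      by (simp add: elliptic_domain_def)
  next
    case False
    have ev: "approx_eigenvalue D z"
      using spectrum_QP_imp_approx_eigenvalue_D[OF z False] .
    then obtain t where t: "z = complex_of_real t" "0 \<le> t" "t \<le> 1"
      using approx_eigenvalue_D_real by blast
    have "t > 0"
      using False t by (cases "t = 0") auto
    note comp = two_dimensional_compression[OF ev[unfolded t(1)]]
    show ?thesis
    proof (cases "t = 1")
      case True
      have one: "1 \<in> ?W"
        using comp[of 1 0] True by simp
      have "complex_of_real s \<in> ?W" if "0 \<le> s" "s \<le> 1" for s
        using convexD[OF convex_closure[OF convex_numerical_range[OF bounded_clinear_QP]] zero one,
            of "1 - s" s] that
        by (simp add: scaleR_conv_of_real)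
      then show ?thesis
        by (auto simp: elliptic_domain_def t(1) True)
    next
      case False
      with t have "t < 1" by simp
      define s where "s = sqrt (t * (1 - t))"
      have s: "s > 0" "s\<^sup>2 = t * (1 - t)"
        using \<open>0 < t\<close> \<open>t < 1\<close> by (simp_all add: s_def)
      show ?thesis
      proof
        fix w assume "w \<in> elliptic_domain (Re z)"
        then obtain a b where ab: "(cmod a)\<^sup>2 + (cmod b)\<^sup>2 = 1"
          "w = complex_of_real t * (a * cnj a) + complex_of_real s * (a * cnj b)"
          using elliptic_domain_parametrization[OF \<open>0 < t\<close> \<open>t < 1\<close>] unfolding s_def t(1)
          by (metis Re_complex_of_real)
        define g where "g = b / complex_of_real s"
        have "(cmod g)\<^sup>2 * (t - t\<^sup>2) = (cmod b)\<^sup>2"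
        proof -
          have "t - t\<^sup>2 = s\<^sup>2"
            unfolding s(2) by (simp add: power2_eq_square algebra_simps)
          then show ?thesis
            using s(1) by (simp add: g_def norm_divide power_divide)
        qed
        then have "(cmod a)\<^sup>2 + (cmod g)\<^sup>2 * (t - t\<^sup>2) = 1"
          using ab(1) by simp
        from comp[OF _ this] \<open>0 < t\<close>
        have "complex_of_real t * (a * cnj (a + g * complex_of_real (1 - t))) \<in> ?W"
          by simp
        also have "complex_of_real t * (a * cnj (a + g * complex_of_real (1 - t)))
            = complex_of_real t * (a * cnj a) + complex_of_real (s\<^sup>2) * (a * cnj g)"
          unfolding s(2) by (simp add: algebra_simps)
        also have "complex_of_real (s\<^sup>2) * (a * cnj g) = complex_of_real s * (a * cnj b)"
          using s(1) by (simp add: g_def power2_eq_square)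
        finally show "w \<in> ?W"
          by (simp only: ab(2))
      qed
    qed
  qed
qed

end

section \<open>Support lines of the numerical range\<close>

text \<open>
  The operator \<open>B = m - A\<close> is positive. Positivity at \<open>x - B x / K\<close>, where \<open>K\<close> bounds
  \<open>B\<close>, gives \<open>\<parallel>B x\<parallel>\<^sup>2 \<le> K \<langle>B x, x\<rangle>\<close>, so a maximising sequence for the quadratic form of
  \<open>A\<close> consists of approximate eigenvectors.
\<close>

lemma maximizing_sequence_approx_eigenvectors:
  fixes A :: "'a::real_inner \<Rightarrow> 'a" and x :: "nat \<Rightarrow> 'a"
  assumes A: "bounded_linear A" and sym: "\<And>x y. inner (A x) y = inner x (A y)"
    and le: "\<And>x. norm x = 1 \<Longrightarrow> inner (A x) x \<le> m"
    and x: "\<And>n. norm (x n) = 1" and lim: "(\<lambda>n. inner (A (x n)) (x n)) \<longlonglongrightarrow> m"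
  shows "(\<lambda>n. A (x n) - m *\<^sub>R x n) \<longlonglongrightarrow> 0"
proof -
  define B where "B y = m *\<^sub>R y - A y" for y
  have "bounded_linear B"
    unfolding B_def by (intro bounded_linear_sub bounded_linear_scaleR_right A)
  then interpret B: bounded_linear B .
  obtain K where K: "K > 0" "\<And>y. norm (B y) \<le> norm y * K"
    using B.pos_bounded by blast
  have B_sym: "inner (B y) z = inner y (B z)" for y z
    by (simp add: B_def inner_diff_left inner_diff_right sym)
  have pos: "inner (B y) y \<ge> 0" for y
  proof (cases "y = 0")
    case False
    interpret A: bounded_linear A by (rule A)
    have "inner (A y) y / (norm y)\<^sup>2 = inner (A (y /\<^sub>R norm y)) (y /\<^sub>R norm y)"
      by (simp add: A.scaleR power2_eq_square divide_simps)
    also have "\<dots> \<le> m"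
      using False by (intro le) simp
    finally have "inner (A y) y \<le> m * (norm y)\<^sup>2"
      using False by (simp add: divide_le_eq)
    then show ?thesis
      by (simp add: B_def inner_diff_left power2_norm_eq_inner)
  qed simp
  have bound: "(norm (B y))\<^sup>2 \<le> K * inner (B y) y" for y
  proof -
    have BB: "inner (B (B y)) (B y) \<le> K * (norm (B y))\<^sup>2"
    proof -
      have "inner (B (B y)) (B y) \<le> norm (B (B y)) * norm (B y)"
        by (rule norm_cauchy_schwarz)
      also have "\<dots> \<le> norm (B y) * K * norm (B y)"
        by (intro mult_right_mono K(2)) simp
      finally show ?thesis
        by (simp add: power2_eq_square mult_ac)
    qed
    have By: "inner (B (B y)) y = (norm (B y))\<^sup>2"
      by (simp add: B_sym power2_norm_eq_inner)
    have "0 \<le> inner (B (K *\<^sub>R y - B y)) (K *\<^sub>R y - B y)"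
      by (rule pos)
    also have "\<dots> = K\<^sup>2 * inner (B y) y - 2 * K * (norm (B y))\<^sup>2 + inner (B (B y)) (B y)"
      by (simp add: B.diff B.scaleR inner_diff_left inner_diff_right By algebra_simps
          flip: power2_norm_eq_inner) (simp add: power2_eq_square)
    also have "\<dots> \<le> K\<^sup>2 * inner (B y) y - K * (norm (B y))\<^sup>2"
      using BB by simp
    finally have "K * (norm (B y))\<^sup>2 \<le> K * (K * inner (B y) y)"
      by (simp add: power2_eq_square mult_ac)
    then show ?thesis
      using K(1) by simp
  qed
  have "inner (B (x n)) (x n) = m - inner (A (x n)) (x n)" for n
    using x[of n] by (simp add: B_def inner_diff_left flip: power2_norm_eq_inner)
  then have "(\<lambda>n. K * inner (B (x n)) (x n)) \<longlonglongrightarrow> K * (m - m)"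
    by (simp only:) (intro tendsto_intros lim)
  then have "(\<lambda>n. (norm (B (x n)))\<^sup>2) \<longlonglongrightarrow> 0"
    by (intro Lim_null_comparison[of "\<lambda>n. (norm (B (x n)))\<^sup>2" "\<lambda>n. K * inner (B (x n)) (x n)"])
       (simp_all add: bound)
  from tendsto_real_sqrt[OF this] have "(\<lambda>n. norm (B (x n))) \<longlonglongrightarrow> 0"
    by simp
  then have "(\<lambda>n. - B (x n)) \<longlonglongrightarrow> - 0"
    by (intro tendsto_minus) (rule tendsto_norm_zero_cancel)
  then show ?thesis
    by (simp add: B_def)
qed

text \<open>
  The equation says \<open>(2 m - t Re a)\<^sup>2 = t - t\<^sup>2 (Im a)\<^sup>2\<close>; its larger solution \<open>m\<close> is
  the value of the support function of the elliptic domain in the direction \<open>a\<close>.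
\<close>

lemma elliptic_domain_support:
  fixes a :: complex
  assumes a: "cmod a = 1" and t: "0 < t" "t \<le> 1"
    and eq: "t\<^sup>2 - (1 + 4 * m * Re a) * t + 4 * m\<^sup>2 = 0"
  shows "\<exists>e\<in>elliptic_domain t. m \<le> inner a e"
proof -
  define c s where "c = Re a" and "s = Im a"
  have cs: "c\<^sup>2 + s\<^sup>2 = 1"
    using a cmod_power2[of a] by (simp add: c_def s_def)
  define R where "R = sqrt (t * c\<^sup>2 + t * (1 - t) * s\<^sup>2)"
  have nn: "0 \<le> t * c\<^sup>2 + t * (1 - t) * s\<^sup>2"
    using t by simp
  have R: "R \<ge> 0" "R\<^sup>2 = t * c\<^sup>2 + t * (1 - t) * s\<^sup>2"
    using nn by (simp_all add: R_def)
  have "(2 * m - c * t)\<^sup>2 = t - t\<^sup>2 + c\<^sup>2 * t\<^sup>2"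
    using eq by (simp add: c_def power2_eq_square algebra_simps)
  also have "\<dots> = t * (c\<^sup>2 + s\<^sup>2) - t\<^sup>2 * (c\<^sup>2 + s\<^sup>2) + c\<^sup>2 * t\<^sup>2"
    by (simp add: cs)
  also have "\<dots> = R\<^sup>2"
    unfolding R(2) by (simp add: power2_eq_square algebra_simps)
  finally have "2 * m - c * t \<le> R"
    using R(1) by (metis abs_le_square_iff abs_of_nonneg abs_ge_self order_refl order_trans)
  then have m: "m \<le> (c * t + R) / 2" by simp
  show ?thesis
  proof (cases "R = 0")
    case True
    have "complex_of_real (t / 2) \<in> elliptic_domain t"
    proof (cases "t = 1")
      case True
      have "complex_of_real (t / 2) \<in> complex_of_real ` {0..1}"
        using t by (intro imageI) simp
      with True show ?thesis
        by (simp add: elliptic_domain_def)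
    next
      case False
      with t show ?thesis
        by (simp add: elliptic_domain_def)
    qed
    moreover have "m \<le> inner a (complex_of_real (t / 2))"
      using m True by (simp add: inner_complex_def c_def)
    ultimately show ?thesis by blast
  next
    case False
    with R(1) have "R > 0" by simp
    \<comment> \<open>The point of the elliptic domain farthest in the direction \<open>a\<close>.\<close>
    define e where "e = Complex (t / 2 + t * c / (2 * R)) (t * (1 - t) * s / (2 * R))"
    have "e \<in> elliptic_domain t"
    proof (cases "t = 1")
      case True
      then have "R = \<bar>c\<bar>"
        by (simp add: R_def)
      then have "c / (2 * R) = 1 / 2 \<or> c / (2 * R) = - 1 / 2"
        using \<open>R > 0\<close> by (auto simp: abs_if field_simps split: if_splits)
      then have "e = complex_of_real 1 \<or> e = complex_of_real 0"
        using True by (auto simp: e_def complex_eq_iff)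
      then show ?thesis
        using True by (auto simp: elliptic_domain_def)
    next
      case False
      with t have t1: "t < 1" by simp
      have "(t * c / (2 * R))\<^sup>2 / (t / 4) = t * c\<^sup>2 / R\<^sup>2"
        using t \<open>R > 0\<close> by (simp add: field_simps power2_eq_square)
      moreover have "(t * (1 - t) * s / (2 * R))\<^sup>2 / (t * (1 - t) / 4) = t * (1 - t) * s\<^sup>2 / R\<^sup>2"
      proof -
        have "(k * s / (2 * R))\<^sup>2 / (k / 4) = k * s\<^sup>2 / R\<^sup>2" if "k \<noteq> 0" for k
          using that \<open>R > 0\<close> by (simp add: field_simps power2_eq_square)
        then show ?thesis
          using t t1 by simp
      qed
      moreover have "t * c\<^sup>2 / R\<^sup>2 + t * (1 - t) * s\<^sup>2 / R\<^sup>2 = 1"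
        unfolding add_divide_distrib[symmetric] R(2)[symmetric] using \<open>R > 0\<close> by simp
      ultimately show ?thesis
        using t t1 by (simp add: elliptic_domain_def e_def)
    qed
    moreover have "inner a e = c * t / 2 + (t * c\<^sup>2 + t * (1 - t) * s\<^sup>2) / (2 * R)"
      using \<open>R > 0\<close> by (simp add: inner_complex_def e_def c_def s_def field_simps power2_eq_square)
    then have "inner a e = (c * t + R) / 2"
      unfolding R(2)[symmetric] using \<open>R > 0\<close> by (simp add: field_simps power2_eq_square)
    ultimately show ?thesis
      using m by force
  qed
qed

lemma complex_quadratic_roots:
  obtains r1 r2 :: complex where "r1 + r2 = p" "r1 * r2 = q"
proof
  let ?d = "csqrt (p\<^sup>2 - 4 * q)"
  show "(p + ?d) / 2 + (p - ?d) / 2 = p"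
    by (simp add: field_simps)
  have "(p + ?d) / 2 * ((p - ?d) / 2) = (p\<^sup>2 - ?d\<^sup>2) / 4"
    by (simp add: power2_eq_square field_simps)
  then show "(p + ?d) / 2 * ((p - ?d) / 2) = q"
    by simp
qed

context two_closed_subspaces
begin

text \<open>
  The self-adjoint part of \<open>cnj a\<close> times \<open>Q \<circ> P\<close>; its quadratic form measures the numerical
  range of \<open>Q \<circ> P\<close> in the direction \<open>a\<close>.
\<close>

definition real_part :: "complex \<Rightarrow> 'a \<Rightarrow> 'a"
  where "real_part a x = (1 / 2) *\<^sub>R (cnj a *\<^sub>C Q (P x) + a *\<^sub>C P (Q x))"

lemma bounded_linear_real_part: "bounded_linear (real_part a)"
  unfolding real_part_def
  by (intro bounded_linear_compose[OF bounded_linear_scaleR_right] bounded_linear_add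
      bounded_linear_compose[OF scaleC.bounded_linear_right]
      bounded_linear_compose[OF P.bounded_linear_axioms Q.bounded_linear_axioms]
      bounded_linear_compose[OF Q.bounded_linear_axioms P.bounded_linear_axioms])

lemma real_part_adj: "cinner (real_part a x) y = cinner x (real_part a y)"
  by (simp add: real_part_def cinner.scaleR_left cinner.scaleR_right cinner_add_left
      cinner_add_right cinner_scaleC_left cinner_scaleC_right P_adj Q_adj add.commute)

lemma inner_real_part: "inner (real_part a x) x = inner a (cinner (Q (P x)) x)"
proof -
  have "cinner (P (Q x)) x = cnj (cinner (Q (P x)) x)"
    by (metis P_adj Q_adj cinner_commute)
  then show ?thesis
    unfolding inner_eq_Re_cinner[of "real_part a x"]
    by (simp add: real_part_def cinner.scaleR_left cinner_add_left cinner_scaleC_left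
        inner_complex_def)
qed

text \<open>
  Applying \<open>P\<close> and \<open>P \<circ> Q\<close> to the approximate eigenvalue equation for \<open>real_part a\<close> and
  eliminating \<open>P (Q x)\<close> leaves a quadratic polynomial in \<open>D\<close> that almost annihilates
  \<open>P x\<close>. One of its linear factors must then fail to be bounded below.
\<close>

lemma approx_eigenvalue_D_from_real_part:
  assumes a: "cmod a = 1" and m: "m \<noteq> 0" and x: "\<And>n::nat. norm (x n) = 1"
    and lim: "(\<lambda>n. real_part a (x n) - m *\<^sub>R x n) \<longlonglongrightarrow> 0"
  obtains t where "approx_eigenvalue D (complex_of_real t)" "0 < t" "t \<le> 1"
    "t\<^sup>2 - (1 + 4 * m * Re a) * t + 4 * m\<^sup>2 = 0"
proof -
  have aa: "a * cnj a = 1"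
    using a by (simp add: complex_norm_square[symmetric])
  interpret D: bounded_linear D
    by (rule bounded_clinear_linear[OF bounded_clinear_D])
  let ?m = "complex_of_real (2 * m)"
  define h where "h n = cnj a *\<^sub>C Q (P (x n)) + a *\<^sub>C P (Q (x n)) - ?m *\<^sub>C x n" for n
  have "h = (\<lambda>n. 2 *\<^sub>R (real_part a (x n) - m *\<^sub>R x n))"
    by (rule ext, simp add: h_def real_part_def scaleR_diff_right, simp add: scaleR_scaleC)
  then have h: "h \<longlonglongrightarrow> 0"
    using tendsto_scaleR[OF tendsto_const[of 2] lim] by simp
  define p r where "p n = P (x n)" and "r n = P (Q (x n))" for n
  have Ph: "P (h n) = cnj a *\<^sub>C D (p n) + a *\<^sub>C r n - ?m *\<^sub>C p n" for n
    by (simp add: h_def p_def r_def D_def P.add P.diff P_scaleC)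
  have PQh: "P (Q (h n)) = cnj a *\<^sub>C D (p n) + a *\<^sub>C D (r n) - ?m *\<^sub>C r n" for n
    by (simp add: h_def p_def r_def D_def P.add P.diff P_scaleC Q.add Q.diff Q_scaleC)
  have ar: "a *\<^sub>C r n = P (h n) - cnj a *\<^sub>C D (p n) + ?m *\<^sub>C p n" for n
    by (simp add: Ph)
  have Ph0: "(\<lambda>n. P (h n)) \<longlonglongrightarrow> 0" and PQh0: "(\<lambda>n. P (Q (h n))) \<longlonglongrightarrow> 0"
    using P.tendsto[OF h] P.tendsto[OF Q.tendsto[OF h]] by (simp_all add: P.zero Q.zero)
  have D_scaleC: "D (c *\<^sub>C y) = c *\<^sub>C D y" for c y
    by (rule bounded_clinear_scaleC[OF bounded_clinear_D])
  have quad: "D (D (p n)) - (1 + 2 * ?m * complex_of_real (Re a)) *\<^sub>C D (p n) + (?m * ?m) *\<^sub>C p n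
      = a *\<^sub>C D (P (h n)) - ?m *\<^sub>C P (h n) - a *\<^sub>C P (Q (h n))" for n
  proof -
    have "a *\<^sub>C P (Q (h n)) = (a * cnj a) *\<^sub>C D (p n) + a *\<^sub>C D (a *\<^sub>C r n) - ?m *\<^sub>C a *\<^sub>C r n"
      by (simp add: PQh scaleC_add_right scaleC.diff_right scaleC_scaleC D_scaleC mult.commute)
    also have "\<dots> = D (p n) + (a *\<^sub>C D (P (h n)) - (a * cnj a) *\<^sub>C D (D (p n)) + (a * ?m) *\<^sub>C D (p n))
        - (?m *\<^sub>C P (h n) - (?m * cnj a) *\<^sub>C D (p n) + (?m * ?m) *\<^sub>C p n)"
      unfolding ar by (simp add: aa D.add D.diff D_scaleC scaleC_add_right scaleC.diff_right scaleC_scaleC)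
    also have "\<dots> = (1 + (a + cnj a) * ?m) *\<^sub>C D (p n) + a *\<^sub>C D (P (h n)) - D (D (p n))
        - ?m *\<^sub>C P (h n) - (?m * ?m) *\<^sub>C p n"
      by (simp add: aa scaleC_add_left algebra_simps)
    also have "(a + cnj a) * ?m = 2 * ?m * complex_of_real (Re a)"
      by (simp add: complex_add_cnj)
    finally show ?thesis
      by (simp add: algebra_simps)
  qed
  obtain r1 r2 where roots: "r1 + r2 = 1 + 2 * ?m * complex_of_real (Re a)" "r1 * r2 = ?m * ?m"
    using complex_quadratic_roots by blast
  define y where "y n = D (p n) - r2 *\<^sub>C p n" for n
  have "D (y n) - r1 *\<^sub>C y n = D (D (p n)) - (r1 + r2) *\<^sub>C D (p n) + (r1 * r2) *\<^sub>C p n" for n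
    by (simp add: y_def D.diff D_scaleC scaleC.diff_right scaleC_add_left scaleC_scaleC)
  then have "D (y n) - r1 *\<^sub>C y n = a *\<^sub>C D (P (h n)) - ?m *\<^sub>C P (h n) - a *\<^sub>C P (Q (h n))" for n
    unfolding roots quad .
  moreover have "(\<lambda>n. a *\<^sub>C D (P (h n)) - ?m *\<^sub>C P (h n) - a *\<^sub>C P (Q (h n)))
      \<longlonglongrightarrow> a *\<^sub>C D 0 - ?m *\<^sub>C 0 - a *\<^sub>C 0"
    by (intro tendsto_diff scaleC.tendsto tendsto_const D.tendsto Ph0 PQh0)
  ultimately have y: "(\<lambda>n. D (y n) - r1 *\<^sub>C y n) \<longlonglongrightarrow> 0"
    by (simp add: D.zero scaleC.zero_right)
  \<comment> \<open>If \<open>P (x n)\<close> tended to \<open>0\<close>, so would \<open>m\<close> times the unit vectors \<open>x n\<close>.\<close>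
  have p: "\<not> p \<longlonglongrightarrow> 0"
  proof
    assume p0: "p \<longlonglongrightarrow> 0"
    have "(\<lambda>n. P (h n) - cnj a *\<^sub>C D (p n) + ?m *\<^sub>C p n) \<longlonglongrightarrow> 0 - cnj a *\<^sub>C D 0 + ?m *\<^sub>C 0"
      by (intro tendsto_diff tendsto_add scaleC.tendsto tendsto_const D.tendsto Ph0 p0)
    then have ar0: "(\<lambda>n. a *\<^sub>C r n) \<longlonglongrightarrow> 0"
      unfolding ar by (simp add: D.zero scaleC.zero_right)
    have "(\<lambda>n. cnj a *\<^sub>C Q (p n) + a *\<^sub>C r n - h n) \<longlonglongrightarrow> cnj a *\<^sub>C Q 0 + 0 - 0"
      by (intro tendsto_diff tendsto_add scaleC.tendsto tendsto_const Q.tendsto p0 ar0 h)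
    then have "(\<lambda>n. ?m *\<^sub>C x n) \<longlonglongrightarrow> 0"
      by (simp add: h_def p_def r_def Q.zero scaleC.zero_right)
    from tendsto_norm_zero[OF this] m show False
      by (simp add: norm_scaleC x norm_mult LIMSEQ_const_iff)
  qed
  obtain z where z: "approx_eigenvalue D z" "z = r1 \<or> z = r2"
  proof (cases "y \<longlonglongrightarrow> 0")
    case True
    from approx_eigenvalueI[OF bounded_clinear_D this[unfolded y_def [abs_def]] p] show ?thesis
      using that[of r2] by simp
  next
    case False
    then show ?thesis
      using approx_eigenvalueI[OF bounded_clinear_D y] that[of r1] by simp
  qed
  obtain t where t: "z = complex_of_real t" "0 \<le> t" "t \<le> 1"
    using approx_eigenvalue_D_real[OF z(1)] by metis
  have "z * z - (r1 + r2) * z + r1 * r2 = 0"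
    using z(2) by (auto simp: algebra_simps)
  then have "complex_of_real (t\<^sup>2 - (1 + 4 * m * Re a) * t + 4 * m\<^sup>2) = 0"
    unfolding roots t(1) by (simp add: power2_eq_square algebra_simps)
  then have eq: "t\<^sup>2 - (1 + 4 * m * Re a) * t + 4 * m\<^sup>2 = 0"
    by (simp only: of_real_eq_0_iff)
  then have "t \<noteq> 0"
    using m by auto
  with that z(1) t eq show ?thesis
    by (metis less_eq_real_def)
qed

text \<open>
  The supremum \<open>m\<close> of the quadratic form of \<open>real_part a\<close> is approached along approximate
  eigenvectors, so it is matched by the elliptic domain of a point of the spectrum. The
  elimination behind this needs \<open>m \<noteq> 0\<close>; when \<open>inner a w \<le> 0\<close> the point \<open>0\<close> of the
  spectrum serves instead.
\<close>

lemma numerical_range_below_support: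
  assumes proper: "M1 \<noteq> UNIV \<or> M2 \<noteq> UNIV" and a: "cmod a = 1"
    and w: "w \<in> numerical_range (Q \<circ> P)"
  shows "\<exists>z\<in>spectrum (Q \<circ> P). \<exists>e\<in>elliptic_domain (Re z). inner a w \<le> inner a e"
proof (cases "inner a w \<le> 0")
  case True
  then show ?thesis
    using zero_in_spectrum_QP[OF proper]
    by (intro bexI[of _ 0]) (simp_all add: elliptic_domain_def)
next
  case False
  define f where "f y = inner (real_part a y) y" for y
  define N where "N = f ` {y. norm y = 1}"
  obtain K where K: "\<And>y. norm (real_part a y) \<le> norm y * K"
    using bounded_linear.bounded[OF bounded_linear_real_part] by blast
  have bdd: "bdd_above N"
  proof (rule bdd_aboveI)
    fix v assume "v \<in> N"
    then obtain y where y: "norm y = 1" "v = f y"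
      by (auto simp: N_def)
    have "f y \<le> norm (real_part a y) * norm y"
      unfolding f_def by (rule norm_cauchy_schwarz)
    with K[of y] y show "v \<le> K" by simp
  qed
  define m where "m = Sup N"
  have f_le: "f y \<le> m" if "norm y = 1" for y
    unfolding m_def using that by (intro cSup_upper bdd) (auto simp: N_def)
  obtain y where y: "norm y = 1" "w = cinner (Q (P y)) y"
    using w by (auto simp: numerical_range_def)
  then have wm: "inner a w \<le> m"
    using f_le[of y] by (simp add: f_def inner_real_part)
  then have "m > 0"
    using False by simp
  have "N \<noteq> {}"
    using y(1) by (auto simp: N_def)
  then have "\<exists>y. norm y = 1 \<and> m - inverse (real (Suc n)) < f y" for n
    using less_cSup_iff[OF _ bdd, of "m - inverse (real (Suc n))"] by (auto simp: N_def m_def)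
  then obtain x where x: "\<And>n. norm (x n) = 1" "\<And>n. m - inverse (real (Suc n)) < f (x n)"
    by metis
  have "(\<lambda>n. f (x n)) \<longlonglongrightarrow> m"
  proof (rule tendsto_sandwich[where f = "\<lambda>n. m - inverse (real (Suc n))" and h = "\<lambda>_. m"])
    show "(\<lambda>n. m - inverse (real (Suc n))) \<longlonglongrightarrow> m"
      using tendsto_diff[OF tendsto_const[of m] LIMSEQ_inverse_real_of_nat] by simp
  qed (use f_le x(1) less_imp_le[OF x(2)] in auto)
  then have "(\<lambda>n. real_part a (x n) - m *\<^sub>R x n) \<longlonglongrightarrow> 0"
    using f_le x(1) unfolding f_def
    by (intro maximizing_sequence_approx_eigenvectors bounded_linear_real_part)
       (simp_all add: inner_eq_Re_cinner real_part_adj)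
  from approx_eigenvalue_D_from_real_part[OF a _ x(1) this] \<open>m > 0\<close>
  obtain t where t: "approx_eigenvalue D (complex_of_real t)" "0 < t" "t \<le> 1"
    "t\<^sup>2 - (1 + 4 * m * Re a) * t + 4 * m\<^sup>2 = 0"
    by auto
  then have "complex_of_real t \<in> spectrum (Q \<circ> P)"
    by (intro approx_eigenvalue_D_imp_spectrum_QP) simp_all
  moreover obtain e where "e \<in> elliptic_domain t" "m \<le> inner a e"
    using elliptic_domain_support[OF a t(2-4)] by blast
  ultimately show ?thesis
    using wm by (intro bexI[of _ "complex_of_real t"] bexI[of _ e]) simp_all
qed

end

theorem theorem1p2:
  fixes M1 M2 :: "'a::complex_hilbert_space set"
  assumes "csubspace M1" and "closed M1"
    and "csubspace M2" and "closed M2"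
    and "M1 \<noteq> UNIV \<or> M2 \<noteq> UNIV"
  shows "closure (numerical_range (orth_proj M2 \<circ> orth_proj M1)) =
    closure (convex hull
      (\<Union>z\<in>spectrum (orth_proj M2 \<circ> orth_proj M1). elliptic_domain (Re z)))"
    (is "closure ?W = closure (convex hull ?U)")
proof
  interpret two_closed_subspaces M1 M2
    by unfold_locales (rule assms)+
  show "closure (convex hull ?U) \<subseteq> closure ?W"
    using elliptic_domain_subset_closure_numerical_range[OF assms(5)]
      convex_closure[OF convex_numerical_range[OF bounded_clinear_QP]]
    by (intro closure_minimal hull_minimal) blast+
  show "closure ?W \<subseteq> closure (convex hull ?U)"
  proof (rule closure_minimal)
    show "?W \<subseteq> closure (convex hull ?U)"
    proof (rule subsetI, rule ccontr)
      fix w assume w: "w \<in> ?W" and "w \<notin> closure (convex hull ?U)"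
      then obtain a b where ab: "inner a w < b" "\<And>v. v \<in> closure (convex hull ?U) \<Longrightarrow> b < inner a v"
        using separating_hyperplane_closed_point[OF convex_closure[OF convex_convex_hull]
            closed_closure, of w ?U] by blast
      have above: "b < inner a v" if "v \<in> ?U" for v
        using ab(2) that by (meson closure_subset hull_inc subsetD)
      have "0 \<in> ?U"
        using zero_in_spectrum_QP[OF assms(5)] by (auto intro!: bexI[of _ 0] simp: elliptic_domain_def)
      from above[OF this] ab(1) have "a \<noteq> 0" by auto
      then have "cmod (- sgn a) = 1"
        by (simp add: norm_sgn)
      then obtain e where "e \<in> ?U" "inner (- sgn a) w \<le> inner (- sgn a) e"
        using numerical_range_below_support[OF assms(5) _ w] by blast
      then have "inner a e \<le> inner a w"
        using \<open>a \<noteq> 0\<close> by (simp add: sgn_div_norm divide_simps)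
      with above[OF \<open>e \<in> ?U\<close>] ab(1) show False by simp
    qed
  qed simp
qed

end
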